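(* Let $X=\{0,1\}^{\mathbb{Z}}$ with Borel $\sigma$-algebra $\mathcal{B}$, let $T:X\to X$ be the full shift, and let $P=\prod_{k\in\mathbb{Z}}P_k$ be a half stationary product probability measure on $X$ such that $(X,\mathcal{B},P,T)$ is non singular (i.e. $(X,\mathcal{B},P,T)$ is a non-singular $K$-shift). Suppose that $(X,\mathcal{B},P,T)$ is conservative and that there is no $T$-invariant probability measure on $X$ which is absolutely continuous with respect to $P$. Then the Maharam extension $\tilde{T}$ of $T$ is a $K$-transformation.
   Context: The full shift is $(Tw)_k=w_{k+1}$. A product measure $P=\prod_{k\in\mathbb{Z}}P_k$ on $\{0,1\}^{\mathbb{Z}}$ (each $P_k$ a probability measure on $\{0,1\}$) is half stationary if there is $p\in(0,1)$ with $P_k(0)=1-P_k(1)=p$ for all $k\le 0$. A non-singular $K$-shift is the full shift on $\{0,1\}^{\mathbb Z}$ with a half stationary product measure for which the shift is non singular. All set equalities are modulo null sets. An invertible measurable transformation $T$ of a standard probability space $(X,\mathcal{B},\mu)$ is non singular if $\mu$ and $\mu\circ T^{-1}$ have the same null sets; then $T':=\frac{d\mu\circ T}{d\mu}$. A set $A\in\mathcal{B}$ is wandering if the sets $\{T^{-n}A\}_{n\ge1}$ are pairwise disjoint; $T$ is conservative if every wandering set is null. The Maharam extension of $T$ is the measure preserving transformation $\tilde{T}$ of $(X\times\mathbb{R},\mathcal{B}\otimes\mathcal{B}_{\mathbb{R}},\mu\otimes e^{-s}ds)$ given by $\tilde{T}(x,y)=(Tx,\,y+\log T'(x))$. An invertible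 transformation $S$ of a measure space $(Y,\mathcal{C},m)$ is a $K$-transformation (has the $K$-property) if there is a sub-$\sigma$-algebra $\mathcal{F}\subset\mathcal{C}$ such that $S^{-1}\mathcal{F}\subset\mathcal{F}$, $\bigcap_{n\in\mathbb{Z}}S^{n}\mathcal{F}=\{\emptyset,Y\}$ modulo $m$, and $\bigvee_{n=1}^{\infty}S^{n}\mathcal{F}=\mathcal{C}$ modulo $m$. *)

theory Defs
  imports "HOL-Probability.Probability"
begin

definition invertible_transformation :: "'a measure \<Rightarrow> ('a \<Rightarrow> 'a) \<Rightarrow> bool" where
  "invertible_transformation M T \<longleftrightarrow>
     bij_betw T (space M) (space M) \<and> T \<in> M \<rightarrow>\<^sub>M M \<and> the_inv_into (space M) T \<in> M \<rightarrow>\<^sub>M M"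

definition nonsingular :: "'a measure \<Rightarrow> ('a \<Rightarrow> 'a) \<Rightarrow> bool" where
  "nonsingular M T \<longleftrightarrow>
     invertible_transformation M T \<and> null_sets (distr M M T) = null_sets M"

text \<open>Following the convention that set equalities are modulo null sets, disjointness is
  understood modulo null sets.\<close>

definition wandering :: "'a measure \<Rightarrow> ('a \<Rightarrow> 'a) \<Rightarrow> 'a set \<Rightarrow> bool" where
  "wandering M T A \<longleftrightarrow> A \<in> sets M \<and>
     (\<forall>m n :: nat. 1 \<le> m \<and> 1 \<le> n \<and> m \<noteq> n \<longrightarrow>
        ((T ^^ m) -` A \<inter> space M) \<inter> ((T ^^ n) -` A \<inter> space M) \<in> null_sets M)"

definition conservative :: "'a measure \<Rightarrow> ('a \<Rightarrow> 'a) \<Rightarrow> bool" where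
  "conservative M T \<longleftrightarrow> (\<forall>A. wandering M T A \<longrightarrow> A \<in> null_sets M)"

definition invariant_measure :: "'a measure \<Rightarrow> ('a \<Rightarrow> 'a) \<Rightarrow> bool" where
  "invariant_measure N T \<longleftrightarrow> T \<in> N \<rightarrow>\<^sub>M N \<and> distr N N T = N"

text \<open>The measure \<open>\<mu> \<circ> T\<close>, that is \<open>A \<mapsto> \<mu> (T A)\<close>, is the push-forward of \<open>\<mu>\<close> under the inverse
  of \<open>T\<close>.\<close>

definition transformation_deriv :: "'a measure \<Rightarrow> ('a \<Rightarrow> 'a) \<Rightarrow> 'a \<Rightarrow> real" where
  "transformation_deriv M T x = enn2real (RN_deriv M (distr M M (the_inv_into (space M) T)) x)"

definition maharam_measure :: "'a measure \<Rightarrow> ('a \<times> real) measure" where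
  "maharam_measure M = M \<Otimes>\<^sub>M density lborel (\<lambda>s. ennreal (exp (- s)))"

text \<open>For non singular \<open>T\<close> the derivative is positive and finite almost everywhere; on the
  exceptional null set the logarithm is \<open>0\<close> by the conventions \<open>enn2real \<infinity> = 0\<close> and \<open>ln 0 = 0\<close>.\<close>

definition maharam_extension :: "'a measure \<Rightarrow> ('a \<Rightarrow> 'a) \<Rightarrow> 'a \<times> real \<Rightarrow> 'a \<times> real" where
  "maharam_extension M T = (\<lambda>(x, y). (T x, y + ln (transformation_deriv M T x)))"

definition int_iterate :: "'a measure \<Rightarrow> ('a \<Rightarrow> 'a) \<Rightarrow> int \<Rightarrow> 'a \<Rightarrow> 'a" where
  "int_iterate M S n =
     (if 0 \<le> n then S ^^ nat n else the_inv_into (space M) S ^^ nat (- n))"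

text \<open>The family \<open>S\<^sup>n \<F> = {S\<^sup>n A | A \<in> \<F>}\<close>.\<close>

definition image_family :: "'a measure \<Rightarrow> ('a \<Rightarrow> 'a) \<Rightarrow> int \<Rightarrow> 'a set set \<Rightarrow> 'a set set" where
  "image_family M S n F = (\<lambda>A. int_iterate M S n ` A) ` F"

definition equal_mod_null :: "'a measure \<Rightarrow> 'a set set \<Rightarrow> 'a set set \<Rightarrow> bool" where
  "equal_mod_null M F G \<longleftrightarrow>
     (\<forall>A\<in>F. \<exists>B\<in>G. sym_diff A B \<in> null_sets M) \<and>
     (\<forall>B\<in>G. \<exists>A\<in>F. sym_diff A B \<in> null_sets M)"

definition K_transformation :: "'a measure \<Rightarrow> ('a \<Rightarrow> 'a) \<Rightarrow> bool" where
  "K_transformation M S \<longleftrightarrow>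
     invertible_transformation M S \<and>
     (\<exists>F. sigma_algebra (space M) F \<and> F \<subseteq> sets M \<and>
        image_family M S (- 1) F \<subseteq> F \<and>
        equal_mod_null M (\<Inter>n. image_family M S n F) {{}, space M} \<and>
        equal_mod_null M (sigma_sets (space M) (\<Union>n\<in>{1..}. image_family M S n F)) (sets M))"

text \<open>The two symbols \<open>0, 1\<close> are \<open>False, True\<close>, so \<open>{0,1}\<^sup>\<int>\<close> is the type \<open>int \<Rightarrow> bool\<close>; its Borel
  \<open>\<sigma>\<close>-algebra is the product \<open>\<sigma>\<close>-algebra.\<close>

definition full_shift :: "(int \<Rightarrow> bool) \<Rightarrow> (int \<Rightarrow> bool)" where
  "full_shift w = (\<lambda>k. w (k + 1))"

abbreviation bernoulli_product :: "(int \<Rightarrow> bool measure) \<Rightarrow> (int \<Rightarrow> bool) measure" where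
  "bernoulli_product P \<equiv> PiM UNIV P"

definition half_stationary :: "(int \<Rightarrow> bool measure) \<Rightarrow> bool" where
  "half_stationary P \<longleftrightarrow>
     (\<forall>k. prob_space (P k) \<and> sets (P k) = sets (count_space UNIV)) \<and>
     (\<exists>p::real. 0 < p \<and> p < 1 \<and>
        (\<forall>k\<le>0. measure (P k) {False} = p \<and> 1 - measure (P k) {True} = p))"

definition nonsingular_K_shift :: "(int \<Rightarrow> bool measure) \<Rightarrow> bool" where
  "nonsingular_K_shift P \<longleftrightarrow> half_stationary P \<and> nonsingular (bernoulli_product P) full_shift"

end

theory Submission
  imports Defs
begin

text \<open>Write \<open>p\<^sub>k(a)\<close> for the mass of \<open>a\<close> under \<open>P\<^sub>k\<close>. The derivative of the shift compares the product of the
\<open>P\<^sub>k\<^sub>-\<^sub>1\<close> with the product of the \<open>P\<^sub>k\<close>, so changing coordinate \<open>k\<close> changes it by a quotient of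
weights only. Let \<open>\<lambda>\<^sub>k\<close> be the logarithm of the odds ratio between \<open>P\<^sub>k\<close> and \<open>P\<^sub>0\<close>; it vanishes for
\<open>k \<le> 0\<close>. Call a set \<^emph>\<open>flip-invariant at \<open>k\<close>\<close> if, almost everywhere, \<open>(w, y)\<close> with \<open>w\<^sub>k = 0\<close> and
\<open>(w', y + \<lambda>\<^sub>k)\<close>, where \<open>w'\<close> has \<open>w'\<^sub>k = 1\<close> instead, lie in it simultaneously. The Maharam extension
\<open>S\<close> carries the flip at \<open>k\<close> to the flip at \<open>k - 1\<close> (\<open>set_flip_inv_vimage_S\<close>).

Let \<open>\<F>\<close> consist of the sets that are flip-invariant at every \<open>k \<le> 0\<close>. Then \<open>S\<^sup>-\<^sup>1 \<F> \<subseteq> \<F>\<close>; the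
family \<open>S\<^sup>n \<F>\<close> contains all events about \<open>y\<close> and the coordinates \<open>k > -n\<close>, so the \<open>S\<^sup>n \<F>\<close> generate;
and a set in \<open>\<Inter>\<^sub>n S\<^sup>n \<F>\<close> is flip-invariant at every coordinate. Everything therefore rests on the
triviality of the sets that are flip-invariant everywhere (\<open>invariant_sets_trivial\<close>).

For that, smooth the indicator of the set along the fibres, so that it becomes a bounded function
\<open>g(w, y)\<close> that is Lipschitz in \<open>y\<close>. By flip invariance, the mean of \<open>g(-, y)\<close> is an average of means
of another such function at \<open>y\<close> minus a random walk with steps \<open>0\<close> or \<open>\<lambda>\<^sub>k\<close>. Two independent copies
of that walk, started at different points, have as difference a symmetric walk. If the steps are at
most \<open>\<epsilon>\<close> and their variances add up to infinity, the difference comes within \<open>\<epsilon>\<close> of zero, and there the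
Lipschitz bound applies: the mean does not depend on \<open>y\<close> (\<open>mean_contraction\<close>,
\<open>mean_translate\<close>). The same holds on every cylinder, so \<open>g\<close> is constant.

The hypotheses supply infinitely much variance from arbitrarily small steps
(\<open>many_small_deviations\<close>). With \<open>d\<^sub>n = p\<^sub>n(0) - p\<^sub>0(0)\<close>, a convergent \<open>\<Sum> d\<^sub>n\<^sup>2\<close> would make the
stationary product an absolutely continuous invariant probability
(\<open>absolutely_continuous_stationary_product\<close>); nonsingularity gives \<open>d\<^sub>n\<^sub>+\<^sub>1 - d\<^sub>n \<rightarrow> 0\<close>
(\<open>dev_jumps\<close>); and if \<open>d\<^sub>n\<close> stayed away from \<open>0\<close>, the place where a random potential attains its
last maximum would yield wandering sets (\<open>dissipative_if_bounded_away\<close>). So either \<open>d\<^sub>n\<close> is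
eventually small and \<open>\<Sum> d\<^sub>n\<^sup>2 = \<infinity>\<close>, or \<open>d\<^sub>n\<close>, moving in small steps, passes through
\<open>[\<kappa>/2, \<kappa>)\<close> in absolute value infinitely often.\<close>

section \<open>Resampling one coordinate\<close>

locale bernoulli_factors =
  fixes P :: "int \<Rightarrow> bool measure"
  assumes prob_P: "\<And>k. prob_space (P k)"
    and sets_P: "\<And>k. sets (P k) = UNIV"
begin

abbreviation X :: "(int \<Rightarrow> bool) measure" where
  "X \<equiv> PiM UNIV P"

definition wt :: "int \<Rightarrow> bool \<Rightarrow> real" where
  "wt k a = measure (P k) {a}"

lemma space_P [simp]: "space (P k) = UNIV"
  using sets.top[of "P k"] sets.sets_into_space[of UNIV "P k"] sets_P[of k] by auto

lemma space_X [simp]: "space X = UNIV"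
  by (simp add: space_PiM)

sublocale X: prob_space X
  by (intro prob_space_PiM prob_P)

lemma sets_P_count: "sets (P k) = sets (count_space UNIV)"
  by (simp add: sets_P)

lemma coord_measurable [measurable]: "(\<lambda>w. w k) \<in> X \<rightarrow>\<^sub>M count_space UNIV"
proof -
  have "(\<lambda>w. w k) \<in> X \<rightarrow>\<^sub>M P k"
    by (rule measurable_component_singleton) simp
  then show ?thesis
    by (subst measurable_cong_sets[OF refl sets_P_count[symmetric, of k]])
qed

lemma measurable_into_X:
  assumes "\<And>k. (\<lambda>x. f x k) \<in> N \<rightarrow>\<^sub>M count_space UNIV"
  shows "f \<in> N \<rightarrow>\<^sub>M X"
proof (rule measurable_PiM_single')
  show "(\<lambda>x. f x k) \<in> N \<rightarrow>\<^sub>M P k" for k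
    using assms[of k] by (subst measurable_cong_sets[OF refl sets_P_count])
qed auto

lemma upd_measurable [measurable]: "(\<lambda>w. w(k := a)) \<in> X \<rightarrow>\<^sub>M X"
  by (rule measurable_into_X) (case_tac "ka = k"; simp)

lemma wt_nonneg [simp]: "0 \<le> wt k a"
  by (simp add: wt_def)

lemma emeasure_P: "emeasure (P k) {a} = ennreal (wt k a)"
proof -
  interpret prob_space "P k" by (rule prob_P)
  show ?thesis unfolding wt_def by (rule emeasure_eq_measure)
qed

lemma wt_sum: "wt k True + wt k False = 1"
proof -
  interpret prob_space "P k" by (rule prob_P)
  have "measure (P k) {True} + measure (P k) {False} = measure (P k) ({True} \<union> {False})"
    by (rule finite_measure_Union[symmetric]) (auto simp: sets_P)
  also have "{True} \<union> {False} = space (P k)" by auto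
  finally show ?thesis using prob_space by (simp add: wt_def)
qed

lemma nn_integral_P:
  fixes f :: "bool \<Rightarrow> ennreal"
  shows "(\<integral>\<^sup>+a. f a \<partial>P k) = wt k True * f True + wt k False * f False"
proof -
  have *: "f = (\<lambda>a. f True * indicator {True} a + f False * indicator {False} a)"
    by (auto simp: fun_eq_iff split: split_indicator)
  have "(\<integral>\<^sup>+a. f a \<partial>P k) = (\<integral>\<^sup>+a. f True * indicator {True} a + f False * indicator {False} a \<partial>P k)"
    using * by simp
  also have "\<dots> = f True * emeasure (P k) {True} + f False * emeasure (P k) {False}"
    by (subst nn_integral_add) (auto simp: nn_integral_cmult_indicator sets_P measurable_def)
  finally show ?thesis by (simp add: emeasure_P mult.commute)
qed

text \<open>Redrawing one coordinate independently leaves a product measure unchanged. All facts about the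
infinite product below are reduced to this one by induction over finitely many coordinates.\<close>

lemma nn_resample:
  fixes f :: "_ \<Rightarrow> ennreal"
  assumes [measurable]: "f \<in> borel_measurable X"
  shows "(\<integral>\<^sup>+w. f w \<partial>X) = wt k True * (\<integral>\<^sup>+w. f (w(k := True)) \<partial>X)
    + wt k False * (\<integral>\<^sup>+w. f (w(k := False)) \<partial>X)"
proof -
  interpret Pk: prob_space "P k" by (rule prob_P)
  have eq: "X = distr (P k \<Otimes>\<^sub>M X) X (\<lambda>(x, w). w(k := x))"
    using distr_pair_PiM_eq_PiM[of UNIV P k] prob_P by simp
  have [measurable]: "(\<lambda>(x, w). w(k := x)) \<in> P k \<Otimes>\<^sub>M X \<rightarrow>\<^sub>M X"
  proof (rule measurable_into_X)
    fix j
    have "fst \<in> P k \<Otimes>\<^sub>M X \<rightarrow>\<^sub>M P k" by measurable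
    then have "fst \<in> P k \<Otimes>\<^sub>M X \<rightarrow>\<^sub>M count_space UNIV"
      by (subst measurable_cong_sets[OF refl sets_P_count[symmetric, of k]])
    moreover have "(\<lambda>z. snd z j) \<in> P k \<Otimes>\<^sub>M X \<rightarrow>\<^sub>M count_space UNIV" by measurable
    ultimately show "(\<lambda>z. (case z of (x, w) \<Rightarrow> w(k := x)) j) \<in> P k \<Otimes>\<^sub>M X \<rightarrow>\<^sub>M count_space UNIV"
      by (cases "j = k") (simp_all add: split_beta')
  qed
  have "(\<integral>\<^sup>+w. f w \<partial>X) = (\<integral>\<^sup>+z. f (case z of (x, w) \<Rightarrow> w(k := x)) \<partial>(P k \<Otimes>\<^sub>M X))"
    by (subst (1) eq, subst nn_integral_distr) simp_all
  also have "\<dots> = (\<integral>\<^sup>+x. \<integral>\<^sup>+w. f (w(k := x)) \<partial>X \<partial>P k)"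
    by (subst X.nn_integral_fst[symmetric]) simp_all
  finally show ?thesis by (simp only: nn_integral_P)
qed

lemma integral_resample:
  fixes f :: "_ \<Rightarrow> real"
  assumes [measurable]: "f \<in> borel_measurable X" and bd: "\<And>w. \<bar>f w\<bar> \<le> B"
  shows "(\<integral>w. f w \<partial>X) = wt k True * (\<integral>w. f (w(k := True)) \<partial>X)
    + wt k False * (\<integral>w. f (w(k := False)) \<partial>X)"
proof -
  have B: "0 \<le> B" using bd[of undefined] by simp
  have nn: "(\<integral>\<^sup>+w. ennreal (g w) \<partial>X) = ennreal (\<integral>w. g w \<partial>X)"
    if [measurable]: "g \<in> borel_measurable X" and "\<And>w. 0 \<le> g w" "\<And>w. g w \<le> 2 * B" for g
    using that by (intro nn_integral_eq_integral X.integrable_const_bound[where B="2*B"]) auto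
  define g where "g w = f w + B" for w
  have [measurable]: "g \<in> borel_measurable X" unfolding g_def by measurable
  have g: "0 \<le> g w" "g w \<le> 2 * B" for w using bd[of w] by (auto simp: g_def)
  have gi: "integrable X (\<lambda>w. g (h w))" if "h \<in> X \<rightarrow>\<^sub>M X" for h
    using that g by (intro X.integrable_const_bound[where B="2*B"]) auto
  have "ennreal (\<integral>w. g w \<partial>X) = ennreal (wt k True * (\<integral>w. g (w(k := True)) \<partial>X)
    + wt k False * (\<integral>w. g (w(k := False)) \<partial>X))"
    using nn_resample[of "\<lambda>w. ennreal (g w)" k] g
    by (simp add: nn ennreal_plus[symmetric] ennreal_mult'[symmetric] integral_nonneg_AE del: ennreal_plus)
  then have *: "(\<integral>w. g w \<partial>X) = wt k True * (\<integral>w. g (w(k := True)) \<partial>X)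
    + wt k False * (\<integral>w. g (w(k := False)) \<partial>X)"
    using g by (subst (asm) ennreal_inj) (auto intro!: integral_nonneg add_nonneg_nonneg mult_nonneg_nonneg)
  have fi: "integrable X (\<lambda>w. f (h w))" if [measurable]: "h \<in> X \<rightarrow>\<^sub>M X" for h
    using bd by (intro X.integrable_const_bound[where B=B]) auto
  have gf: "(\<integral>w. g (h w) \<partial>X) = (\<integral>w. f (h w) \<partial>X) + B" if "h \<in> X \<rightarrow>\<^sub>M X" for h
    unfolding g_def using fi[OF that] X.prob_space by simp
  have "(\<integral>w. f w \<partial>X) + B = wt k True * (\<integral>w. f (w(k := True)) \<partial>X)
    + wt k False * (\<integral>w. f (w(k := False)) \<partial>X) + (wt k True + wt k False) * B"
    using * gf[of "\<lambda>w. w"] gf[of "\<lambda>w. w(k:=True)"] gf[of "\<lambda>w. w(k:=False)"] by (simp add: algebra_simps)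
  then show ?thesis by (simp add: wt_sum)
qed

lemma AE_upd:
  assumes pos: "0 < wt k a" and ae: "AE w in X. Q w"
  shows "AE w in X. Q (w(k := a))"
proof -
  obtain N where N: "{w. \<not> Q w} \<subseteq> N" "emeasure X N = 0" and [measurable]: "N \<in> sets X"
    using ae by (auto elim!: AE_E)
  have "0 = (\<integral>\<^sup>+w. indicator N w \<partial>X)" using N by simp
  also have "\<dots> = wt k True * (\<integral>\<^sup>+w. indicator N (w(k := True)) \<partial>X)
    + wt k False * (\<integral>\<^sup>+w. indicator N (w(k := False)) \<partial>X)"
    by (rule nn_resample) simp
  finally have "(\<integral>\<^sup>+w. indicator N (w(k := a)) \<partial>X) = 0"
    using pos by (cases a) (auto simp: ennreal_eq_0_iff add_eq_0_iff_both_eq_0)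
  then have "AE w in X. (indicator N (w(k := a)) :: ennreal) = 0"
    by (subst (asm) nn_integral_0_iff_AE) simp_all
  then show ?thesis
    by eventually_elim (use N in \<open>auto simp: indicator_eq_0_iff\<close>)
qed

end

section \<open>Means of flip-invariant functions\<close>

locale positive_factors = bernoulli_factors +
  assumes wt_pos: "\<And>k a. 0 < wt k a"
begin

definition lipschitz_family :: "((int \<Rightarrow> bool) \<Rightarrow> real \<Rightarrow> real) \<Rightarrow> bool" where
  "lipschitz_family g \<longleftrightarrow> (\<forall>y. (\<lambda>w. g w y) \<in> borel_measurable X) \<and>
     (\<forall>w y. 0 \<le> g w y \<and> g w y \<le> 1) \<and> (\<forall>w y z. \<bar>g w y - g w z\<bar> \<le> \<bar>y - z\<bar>)"

definition flip_inv :: "(int \<Rightarrow> real) \<Rightarrow> int \<Rightarrow> ((int \<Rightarrow> bool) \<Rightarrow> real \<Rightarrow> real) \<Rightarrow> bool" where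
  "flip_inv l k g \<longleftrightarrow> (AE w in X. \<forall>y. g (w(k := True)) (y + l k) = g (w(k := False)) y)"

text \<open>The function whose independence of \<open>y\<close> is the heart of the argument.\<close>

definition mean :: "((int \<Rightarrow> bool) \<Rightarrow> real \<Rightarrow> real) \<Rightarrow> real \<Rightarrow> real" where
  "mean g y = (\<integral>w. g w y \<partial>X)"

lemma lipschitz_family_upd: "lipschitz_family g \<Longrightarrow> lipschitz_family (\<lambda>w. g (w(k := a)))"
  unfolding lipschitz_family_def by (auto intro: measurable_compose[OF upd_measurable])

lemma lipschitz_family_integrable: "lipschitz_family g \<Longrightarrow> integrable X (\<lambda>w. g w y)"
  unfolding lipschitz_family_def by (intro X.integrable_const_bound[where B=1]) auto

lemma mean_bounds: "lipschitz_family g \<Longrightarrow> 0 \<le> mean g y \<and> mean g y \<le> 1"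
  unfolding mean_def
  by (intro conjI X.integral_le_const lipschitz_family_integrable Bochner_Integration.integral_nonneg)
     (auto simp: lipschitz_family_def)

lemma mean_lip:
  assumes "lipschitz_family g" shows "\<bar>mean g y - mean g z\<bar> \<le> \<bar>y - z\<bar>"
proof -
  have "mean g y - mean g z = (\<integral>w. g w y - g w z \<partial>X)"
    unfolding mean_def using assms by (simp add: lipschitz_family_integrable)
  moreover have "\<bar>\<integral>w. g w y - g w z \<partial>X\<bar> \<le> (\<integral>w. \<bar>g w y - g w z\<bar> \<partial>X)"
    by (rule integral_abs_bound)
  moreover have "(\<integral>w. \<bar>g w y - g w z\<bar> \<partial>X) \<le> \<bar>y - z\<bar>"
    using assms by (intro X.integral_le_const integrable_abs Bochner_Integration.integrable_diff lipschitz_family_integrable)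
      (auto simp: lipschitz_family_def)
  ultimately show ?thesis by linarith
qed

lemma flip_inv_upd:
  assumes "flip_inv l i g" "i \<noteq> k" shows "flip_inv l i (\<lambda>w. g (w(k := a)))"
  using AE_upd[OF wt_pos[of k a] assms(1)[unfolded flip_inv_def]] assms(2)
  unfolding flip_inv_def by (simp add: fun_upd_twist)

lemma mean_resample:
  assumes "lipschitz_family g"
  shows "mean g y = wt k True * mean (\<lambda>w. g (w(k := True))) y + wt k False * mean (\<lambda>w. g (w(k := False))) y"
  unfolding mean_def using assms
  by (intro integral_resample[where B=1]) (auto simp: lipschitz_family_def)

lemma mean_upd_True:
  assumes "lipschitz_family g" "flip_inv l k g"
  shows "mean (\<lambda>w. g (w(k := True))) y = mean (\<lambda>w. g (w(k := False))) (y - l k)"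
  unfolding mean_def
proof (rule integral_cong_AE)
  show "AE w in X. g (w(k := True)) y = g (w(k := False)) (y - l k)"
    using assms(2) unfolding flip_inv_def
    by eventually_elim (metis diff_add_cancel)
qed (use assms(1) in \<open>auto simp: lipschitz_family_def intro: measurable_compose[OF upd_measurable]\<close>)

text \<open>Each flip-invariant coordinate \<open>k\<close> exhibits the mean as the average of a mean \<open>h\<close> at \<open>t\<close> and at
\<open>t - l k\<close>. Drawing the coordinate independently at the two points \<open>t\<close> and \<open>t + d\<close> turns their
distance \<open>d\<close> into \<open>d\<close>, \<open>d - l k\<close> or \<open>d + l k\<close>, a martingale. The bound is a barrier for this walk on
\<open>[0, R + e]\<close>: \<open>e\<close> accounts for the walk being caught near \<open>0\<close>, \<open>d / R\<close> for its escape beyond \<open>R\<close>, and the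
last term for its survival in between. The parabola \<open>d * (R + e - d)\<close> drops by the variance in every
step, hence by a definite factor, because it is at most \<open>(R + e)\<^sup>2 / 4\<close>.\<close>

lemma mean_contraction:
  fixes l :: "int \<Rightarrow> real" and I :: "int set"
  assumes fin: "finite I" and e: "0 < e" and R: "0 < R" and small: "\<And>k. k \<in> I \<Longrightarrow> \<bar>l k\<bar> \<le> e"
  defines "S \<equiv> \<lambda>I. \<Sum>k\<in>I. wt k True * wt k False * (l k)\<^sup>2"
  shows "lipschitz_family g \<Longrightarrow> (\<And>k. k \<in> I \<Longrightarrow> flip_inv l k g) \<Longrightarrow> 0 \<le> d \<Longrightarrow> d \<le> R + e \<Longrightarrow>
    \<bar>mean g t - mean g (t + d)\<bar> \<le> e + d / R + d * (R + e - d) / (e * R) * exp (- 8 * S I / (R + e)\<^sup>2)"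
  using fin small
proof (induction I arbitrary: g t d rule: finite_induct)
  case empty
  have nn: "0 \<le> d * (R + e - d) / (e * R) * exp (- 8 * S {} / (R + e)\<^sup>2)"
    using e R empty.prems by (intro mult_nonneg_nonneg divide_nonneg_nonneg) auto
  have b: "\<bar>mean g t - mean g (t + d)\<bar> \<le> 1" "\<bar>mean g t - mean g (t + d)\<bar> \<le> d"
    using mean_bounds[OF empty.prems(1), of t] mean_bounds[OF empty.prems(1), of "t+d"]
      mean_lip[OF empty.prems(1), of t "t + d"] empty.prems by auto
  consider "d \<le> e" | "R \<le> d" | "e < d" "d < R" by linarith
  then show ?case
  proof cases
    case 1
    then show ?thesis using nn b(2) divide_nonneg_nonneg[of d R] empty.prems R by linarith
  next
    case 2
    then have "1 \<le> d / R" using R by simp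
    then show ?thesis using nn b(1) e by linarith
  next
    case 3
    have "0 \<le> (d - e) * (R - d)" using 3 by simp
    then have "e * R \<le> d * (R + e - d)" by (simp add: algebra_simps)
    then have "1 \<le> d * (R + e - d) / (e * R)" using e R by (simp add: field_simps)
    moreover have "0 \<le> d / R" using 3 R e by simp
    ultimately show ?thesis using b(1) e by (simp add: S_def)
  qed
next
  case (insert k I)
  define h where "h = (\<lambda>w. g (w(k := False)))"
  define p q r where "p = wt k True" and "q = wt k False" and "r = l k"
  define \<alpha> where "\<alpha> = exp (- 8 * S I / (R + e)\<^sup>2)"
  define b where "b d = e + d / R + d * (R + e - d) / (e * R) * \<alpha>" for d
  have pq: "p + q = 1" "0 \<le> p" "0 \<le> q" by (auto simp: p_def q_def wt_sum)
  have r: "\<bar>r\<bar> \<le> e" using insert.prems by (simp add: r_def)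
  have \<alpha>: "0 < \<alpha>" by (simp add: \<alpha>_def)
  have nn: "0 \<le> d * (R + e - d) / (e * R) * exp (- 8 * S (insert k I) / (R + e)\<^sup>2)"
    using e R insert.prems by (intro mult_nonneg_nonneg divide_nonneg_nonneg) auto
  have bnd: "\<bar>mean g t - mean g (t + d)\<bar> \<le> 1" "\<bar>mean g t - mean g (t + d)\<bar> \<le> d"
    using mean_bounds[OF insert.prems(1), of t] mean_bounds[OF insert.prems(1), of "t+d"]
      mean_lip[OF insert.prems(1), of t "t + d"] insert.prems by auto
  have h: "lipschitz_family h" unfolding h_def by (rule lipschitz_family_upd[OF insert.prems(1)])
  have hinv: "flip_inv l i h" if "i \<in> I" for i
    unfolding h_def using that insert.hyps insert.prems by (intro flip_inv_upd) auto
  have IH: "\<bar>mean h t - mean h (t + d)\<bar> \<le> b d" if "0 \<le> d" "d \<le> R + e" for t d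
    unfolding b_def \<alpha>_def using insert.IH[OF h hinv that] insert.prems by auto
  have mg: "mean g t = p * mean h (t - r) + q * mean h t" for t
    using mean_resample[OF insert.prems(1), of t k] mean_upd_True[OF insert.prems(1) insert.prems(2)[of k], of t]
    by (simp only: p_def q_def r_def h_def insertI1 simp_thms)
  \<comment> \<open>Only in the third case is the new coordinate used; the walk is stopped outside \<open>(e, R)\<close>.\<close>
  consider "d \<le> e" | "R \<le> d" | "e < d" "d < R" by linarith
  then show ?case
  proof cases
    case 1
    then show ?thesis using nn bnd(2) divide_nonneg_nonneg[of d R] insert.prems R by linarith
  next
    case 2
    then have "1 \<le> d / R" using R by simp
    then show ?thesis using nn bnd(1) e by linarith
  next
    case 3
    define x1 x2 x3 x4 where "x1 = mean h t - mean h (t + d)"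
      and "x2 = mean h (t - r) - mean h (t - r + d)"
      and "x3 = mean h t - mean h (t + (d - r))"
      and "x4 = mean h (t - r) - mean h (t - r + (d + r))"
    have x: "\<bar>x1\<bar> \<le> b d" "\<bar>x2\<bar> \<le> b d" "\<bar>x3\<bar> \<le> b (d - r)" "\<bar>x4\<bar> \<le> b (d + r)"
      unfolding x1_def x2_def x3_def x4_def by (rule IH; use 3 r e R in linarith)+
    \<comment> \<open>The factors \<open>p + q = 1\<close> expand the difference over two independent draws of coordinate \<open>k\<close>.\<close>
    have "mean g t - mean g (t + d) =
        (p + q) * (p * mean h (t - r) + q * mean h t) - (p + q) * (p * mean h (t + d - r) + q * mean h (t + d))"
      by (simp add: mg pq)
    also have "\<dots> = q * q * x1 + p * p * x2 + p * q * x3 + p * q * x4"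
      by (simp add: x1_def x2_def x3_def x4_def algebra_simps)
    finally have "\<bar>mean g t - mean g (t + d)\<bar> \<le> \<bar>q * q * x1\<bar> + \<bar>p * p * x2\<bar> + \<bar>p * q * x3\<bar> + \<bar>p * q * x4\<bar>"
      by linarith
    also have "\<dots> = q * q * \<bar>x1\<bar> + p * p * \<bar>x2\<bar> + p * q * \<bar>x3\<bar> + p * q * \<bar>x4\<bar>"
      using pq by (simp add: abs_mult)
    also have "\<dots> \<le> q * q * b d + p * p * b d + p * q * b (d - r) + p * q * b (d + r)"
      using x pq by (intro add_mono mult_left_mono) auto
    also have "\<dots> = (p + q)\<^sup>2 * b d - 2 * p * q * r\<^sup>2 * \<alpha> / (e * R)"
      using e R by (simp add: b_def power2_eq_square field_simps)
    also have "\<dots> = e + d / R + (d * (R + e - d) - 2 * p * q * r\<^sup>2) / (e * R) * \<alpha>"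
      using e R by (simp add: pq b_def field_simps)
    also have "\<dots> \<le> e + d / R + (d * (R + e - d) * exp (- 8 * (p * q * r\<^sup>2) / (R + e)\<^sup>2)) / (e * R) * \<alpha>"
    proof -
      define D v where "D = d * (R + e - d)" and "v = p * q * r\<^sup>2"
      have D: "0 \<le> D" unfolding D_def using 3 e R by (intro mult_nonneg_nonneg) auto
      have v: "0 \<le> v" unfolding v_def using pq by simp
      have Re: "0 < (R + e)\<^sup>2" using e R by simp
      have "0 \<le> (2 * d - (R + e))\<^sup>2" by simp
      then have D4: "4 * D \<le> (R + e)\<^sup>2" by (simp add: D_def power2_eq_square algebra_simps)
      have "4 * D * v \<le> (R + e)\<^sup>2 * v" using D4 v by (rule mult_right_mono)
      then have "D * 8 * v / (R + e)\<^sup>2 \<le> 2 * v" using Re by (simp add: field_simps)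
      then have "D - 2 * v \<le> D * (1 + (- 8 * v / (R + e)\<^sup>2))" by (simp add: algebra_simps)
      also have "\<dots> \<le> D * exp (- 8 * v / (R + e)\<^sup>2)"
        using D by (intro mult_left_mono exp_ge_add_one_self)
      finally show ?thesis using e R \<alpha> unfolding D_def v_def
        by (intro add_left_mono mult_right_mono divide_right_mono) (auto simp: mult.assoc)
    qed
    also have "\<dots> = e + d / R + d * (R + e - d) / (e * R) * exp (- 8 * S (insert k I) / (R + e)\<^sup>2)"
    proof -
      have "S (insert k I) = p * q * r\<^sup>2 + S I"
        using insert.hyps by (simp add: S_def p_def q_def r_def)
      then have "exp (- 8 * S (insert k I) / (R + e)\<^sup>2) = exp (- 8 * (p * q * r\<^sup>2) / (R + e)\<^sup>2) * \<alpha>"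
        by (simp add: \<alpha>_def exp_add[symmetric] add_divide_distrib diff_divide_distrib)
      then show ?thesis by simp
    qed
    finally show ?thesis .
  qed
qed

text \<open>Infinite total variance of the steps \<open>l k\<close>, even when only steps of size at most \<open>e\<close> are counted and
finitely many coordinates are set aside.\<close>

definition abundant :: "(int \<Rightarrow> real) \<Rightarrow> bool" where
  "abundant l \<longleftrightarrow> (\<forall>e>0. \<forall>B. \<forall>J. finite J \<longrightarrow> (\<exists>I. finite I \<and> I \<inter> J = {} \<and> (\<forall>k\<in>I. \<bar>l k\<bar> \<le> e) \<and>
     B \<le> (\<Sum>k\<in>I. wt k True * wt k False * (l k)\<^sup>2)))"

lemma mean_translate:
  assumes ab: "abundant l" and g: "lipschitz_family g" and J: "finite J" "\<And>k. k \<notin> J \<Longrightarrow> flip_inv l k g"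
  shows "mean g y = mean g z"
proof -
  have main: "mean g t = mean g (t + d)" if d: "0 \<le> d" for t d
  proof -
    have "\<bar>mean g t - mean g (t + d)\<bar> \<le> 0 + e" if e: "0 < e" for e
    proof -
      define e' where "e' = e / 3"
      have e': "0 < e'" using e by (simp add: e'_def)
      define R where "R = d / e' + d + 1"
      have R: "0 < R" "d \<le> R" using d e' by (auto simp: R_def intro: add_nonneg_pos)
      have "d \<le> e' * R" using d e' by (simp add: R_def algebra_simps)
      then have dR: "d / R \<le> e'" using R by (simp add: field_simps)
      define C where "C = d * (R + e' - d) / (e' * R)"
      have C: "0 \<le> C" unfolding C_def using d R e' by (intro divide_nonneg_nonneg mult_nonneg_nonneg) auto
      \<comment> \<open>The total variance that makes the survival term at most \<open>e'\<close>.\<close>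
      define B where "B = (R + e')\<^sup>2 * ln ((C + 1) / e') / 8"
      obtain I where I: "finite I" "I \<inter> J = {}" "\<And>k. k \<in> I \<Longrightarrow> \<bar>l k\<bar> \<le> e'"
        "B \<le> (\<Sum>k\<in>I. wt k True * wt k False * (l k)\<^sup>2)"
        using ab J(1) e' unfolding abundant_def by metis
      let ?S = "\<Sum>k\<in>I. wt k True * wt k False * (l k)\<^sup>2"
      have Re: "0 < (R + e')\<^sup>2" using e' R by simp
      have "\<bar>mean g t - mean g (t + d)\<bar> \<le> e' + d / R + C * exp (- 8 * ?S / (R + e')\<^sup>2)"
        unfolding C_def using I J e' R d g by (intro mean_contraction) auto
      also have "exp (- 8 * ?S / (R + e')\<^sup>2) \<le> exp (- ln ((C + 1) / e'))"
      proof -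
        have "(R + e')\<^sup>2 * ln ((C + 1) / e') \<le> 8 * ?S" using I(4) by (simp add: B_def)
        then have "ln ((C + 1) / e') \<le> 8 * ?S / (R + e')\<^sup>2" using Re by (simp add: field_simps)
        then show ?thesis by simp
      qed
      also have "exp (- ln ((C + 1) / e')) = e' / (C + 1)"
        using C e' by (simp add: exp_minus)
      also have "C * (e' / (C + 1)) \<le> e'"
        using C e' by (simp add: field_simps)
      finally have "\<bar>mean g t - mean g (t + d)\<bar> \<le> e' + d / R + e'"
        using C by (simp only: mult_left_mono add_left_mono)
      then show ?thesis using dR e'_def by linarith
    qed
    then have "\<bar>mean g t - mean g (t + d)\<bar> \<le> 0" by (rule field_le_epsilon)
    then show ?thesis by simp
  qed
  consider "y \<le> z" | "z \<le> y" by linarith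
  then show ?thesis
  proof cases
    case 1
    then show ?thesis using main[of "z - y" y] by simp
  next
    case 2
    then show ?thesis using main[of "y - z" z] by simp
  qed
qed

text \<open>Fixing coordinates destroys their flip invariance. This class is closed under fixing coordinates
because a coordinate that has been fixed no longer matters.\<close>

definition cofinitely_inv :: "(int \<Rightarrow> real) \<Rightarrow> ((int \<Rightarrow> bool) \<Rightarrow> real \<Rightarrow> real) \<Rightarrow> bool" where
  "cofinitely_inv l g \<longleftrightarrow> lipschitz_family g \<and>
     (\<exists>J. finite J \<and> (\<forall>k. k \<notin> J \<longrightarrow> flip_inv l k g) \<and> (\<forall>k\<in>J. \<forall>w b. g (w(k := b)) = g w))"

text \<open>Flip invariance relates the two ways of fixing a coordinate by a translation in \<open>y\<close>, to which means
are insensitive; so fixing a coordinate does not change the mean.\<close>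

lemma cofinitely_inv_upd:
  assumes ab: "abundant l" and g: "cofinitely_inv l g"
  shows "cofinitely_inv l (\<lambda>w. g (w(k := a)))" "mean (\<lambda>w. g (w(k := a))) y = mean g y"
proof -
  obtain J where J: "finite J" "\<And>k. k \<notin> J \<Longrightarrow> flip_inv l k g" "\<And>k w b. k \<in> J \<Longrightarrow> g (w(k := b)) = g w"
    and lip: "lipschitz_family g"
    using g unfolding cofinitely_inv_def by metis
  have inv: "flip_inv l i (\<lambda>w. g (w(k := a)))" if "i \<notin> insert k J" for i a
    using that J by (intro flip_inv_upd) auto
  have lipu: "lipschitz_family (\<lambda>w. g (w(k := a)))" for a by (rule lipschitz_family_upd[OF lip])
  show "cofinitely_inv l (\<lambda>w. g (w(k := a)))"
    unfolding cofinitely_inv_def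
  proof (intro conjI exI[of _ "insert k J"] allI impI ballI)
    fix i w b assume "i \<in> insert k J"
    then show "g (w(i := b, k := a)) = g (w(k := a))"
      using J(3)[of i "w(k := a)" b] by (cases "i = k") (auto simp: fun_upd_twist)
  qed (use lipu inv J in auto)
  show "mean (\<lambda>w. g (w(k := a))) y = mean g y"
  proof (cases "k \<in> J")
    case True
    then show ?thesis using J(3)[of k] by (simp add: mean_def)
  next
    case False
    have tr: "mean (\<lambda>w. g (w(k := False))) y = mean (\<lambda>w. g (w(k := False))) (y - l k)"
      using J(1) by (intro mean_translate[OF ab lipu, of "insert k J"] inv) auto
    have TF: "mean (\<lambda>w. g (w(k := True))) y = mean (\<lambda>w. g (w(k := False))) y"
      using mean_upd_True[OF lip J(2)[OF False]] tr by simp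
    have "mean g y = (wt k True + wt k False) * mean (\<lambda>w. g (w(k := False))) y"
      using mean_resample[OF lip, of y k] TF by (simp add: algebra_simps)
    then show ?thesis using TF by (cases a) (auto simp: wt_sum)
  qed
qed

lemma box_sets: "finite J \<Longrightarrow> {w. \<forall>j\<in>J. w j \<in> A j} \<in> sets X"
proof -
  assume "finite J"
  then have "{w \<in> space X. \<forall>j\<in>J. w j \<in> A j} \<in> sets X" by measurable
  then show ?thesis by simp
qed

lemma cofinitely_inv_box:
  assumes ab: "abundant l" and "finite J"
  shows "cofinitely_inv l g \<Longrightarrow> (\<integral>w. indicator {w. \<forall>j\<in>J. w j \<in> A j} w * g w y \<partial>X)
     = X.prob {w. \<forall>j\<in>J. w j \<in> A j} * mean g y"
  using \<open>finite J\<close>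
proof (induction J arbitrary: g rule: finite_induct)
  case empty
  then show ?case using X.prob_space by (simp add: mean_def)
next
  case (insert k J)
  let ?B = "\<lambda>J. {w. \<forall>j\<in>J. w j \<in> A j}"
  have [measurable]: "?B (insert k J) \<in> sets X" "?B J \<in> sets X"
    using box_sets[of "insert k J" A] box_sets[of J A] insert.hyps by simp_all
  have ind: "indicator (?B (insert k J)) (w(k := a)) = (indicator (A k) a * indicator (?B J) w :: real)" for w a
    using insert.hyps by (auto split: split_indicator)
  have bd: "\<bar>g w y\<bar> \<le> 1" and [measurable]: "(\<lambda>w. g w y) \<in> borel_measurable X" for w
    using insert.prems by (auto simp: cofinitely_inv_def lipschitz_family_def)
  have IH: "(\<integral>w. indicator (?B J) w * g (w(k := a)) y \<partial>X) = X.prob (?B J) * mean g y" for a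
    using insert.IH[OF cofinitely_inv_upd(1)[OF ab insert.prems], of k a] cofinitely_inv_upd(2)[OF ab insert.prems, of k a y]
    by (simp only:)
  have E: "(\<integral>w. indicator (?B (insert k J)) (w(k := a)) * g (w(k := a)) y \<partial>X)
    = indicator (A k) a * (X.prob (?B J) * mean g y)" for a
  proof -
    have "(\<integral>w. indicator (?B (insert k J)) (w(k := a)) * g (w(k := a)) y \<partial>X)
      = (\<integral>w. indicator (A k) a * (indicator (?B J) w * g (w(k := a)) y) \<partial>X)"
      unfolding ind mult.assoc ..
    also have "\<dots> = indicator (A k) a * (\<integral>w. indicator (?B J) w * g (w(k := a)) y \<partial>X)"
      by (rule integral_mult_right_zero)
    finally show ?thesis unfolding IH .
  qed
  have "(\<integral>w. indicator (?B (insert k J)) w * g w y \<partial>X) =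
    wt k True * (\<integral>w. indicator (?B (insert k J)) (w(k := True)) * g (w(k := True)) y \<partial>X)
    + wt k False * (\<integral>w. indicator (?B (insert k J)) (w(k := False)) * g (w(k := False)) y \<partial>X)"
    using bd by (intro integral_resample[where B=1]) (auto split: split_indicator)
  also have "\<dots> = wt k True * indicator (A k) True * (X.prob (?B J) * mean g y)
     + wt k False * indicator (A k) False * (X.prob (?B J) * mean g y)"
    unfolding E by (simp only: mult.assoc)
  finally have 1: "(\<integral>w. indicator (?B (insert k J)) w * g w y \<partial>X) = \<dots>" .
  have "X.prob (?B (insert k J)) = (\<integral>w. indicator (?B (insert k J)) w \<partial>X)"
    by simp
  also have "\<dots> = wt k True * (\<integral>w. indicator (?B (insert k J)) (w(k := True)) \<partial>X)
    + wt k False * (\<integral>w. indicator (?B (insert k J)) (w(k := False)) \<partial>X)"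
    by (intro integral_resample[where B=1]) (auto split: split_indicator)
  also have "\<dots> = wt k True * indicator (A k) True * X.prob (?B J)
     + wt k False * indicator (A k) False * X.prob (?B J)"
    unfolding ind by simp
  finally have 2: "X.prob (?B (insert k J)) = \<dots>" .
  show ?case unfolding 1 2 by (simp add: algebra_simps)
qed

text \<open>The density \<open>g(-, y)\<close> and its mean define measures that agree on all finite-dimensional boxes.\<close>

lemma cofinitely_inv_AE_const:
  assumes ab: "abundant l" and g: "cofinitely_inv l g"
  shows "AE w in X. g w y = mean g y"
proof -
  have bd: "0 \<le> g w y" "g w y \<le> 1" and [measurable]: "(\<lambda>w. g w y) \<in> borel_measurable X"
    and int: "integrable X (\<lambda>w. g w y)" for w
    using g by (auto simp: cofinitely_inv_def lipschitz_family_def intro!: lipschitz_family_integrable)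
  have mnn: "0 \<le> mean g y" unfolding mean_def using bd by (intro Bochner_Integration.integral_nonneg)
  have eq: "density X (\<lambda>w. ennreal (g w y)) = density X (\<lambda>w. ennreal (mean g y))"
  proof (rule measure_eqI_PiM_infinite[where I=UNIV and M=P])
    fix A :: "int \<Rightarrow> bool set" and J :: "int set"
    assume J: "finite J"
    have pe: "prod_emb UNIV P J (Pi\<^sub>E J A) = {w. \<forall>j\<in>J. w j \<in> A j}"
      by (auto simp: prod_emb_def PiE_iff)
    note [measurable] = box_sets[OF J, of A]
    have "emeasure (density X (\<lambda>w. ennreal (g w y))) {w. \<forall>j\<in>J. w j \<in> A j}
      = (\<integral>\<^sup>+w. ennreal (indicator {w. \<forall>j\<in>J. w j \<in> A j} w * g w y) \<partial>X)"
      by (subst emeasure_density) (auto intro!: nn_integral_cong split: split_indicator)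
    also have "\<dots> = ennreal (\<integral>w. indicator {w. \<forall>j\<in>J. w j \<in> A j} w * g w y \<partial>X)"
      using bd by (intro nn_integral_eq_integral X.integrable_const_bound[where B=1]) (auto split: split_indicator)
    also have "\<dots> = ennreal (mean g y) * emeasure X {w. \<forall>j\<in>J. w j \<in> A j}"
      unfolding cofinitely_inv_box[OF ab J g] using mnn by (simp add: X.emeasure_eq_measure ennreal_mult' mult.commute)
    also have "\<dots> = emeasure (density X (\<lambda>w. ennreal (mean g y))) {w. \<forall>j\<in>J. w j \<in> A j}"
      by (subst emeasure_density) (auto simp: nn_integral_cmult_indicator)
    finally show "emeasure (density X (\<lambda>w. ennreal (g w y))) (prod_emb UNIV P J (Pi\<^sub>E J A)) =
       emeasure (density X (\<lambda>w. ennreal (mean g y))) (prod_emb UNIV P J (Pi\<^sub>E J A))"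
      unfolding pe .
  next
    show "finite_measure (density X (\<lambda>w. ennreal (g w y)))"
    proof (rule finite_measureI)
      have "emeasure (density X (\<lambda>w. ennreal (g w y))) (space X) = (\<integral>\<^sup>+w. ennreal (g w y) \<partial>X)"
        by (subst emeasure_density) (auto intro!: nn_integral_cong simp del: space_X)
      then show "emeasure (density X (\<lambda>w. ennreal (g w y))) (space (density X (\<lambda>w. ennreal (g w y)))) \<noteq> \<infinity>"
        using int bd by (simp add: nn_integral_eq_integral)
    qed
  qed auto
  have "AE w in X. ennreal (g w y) = ennreal (mean g y)"
    using eq by (intro X.density_unique) simp_all
  then show ?thesis by eventually_elim (use bd mnn in auto)
qed

end

section \<open>Triviality of flip-invariant sets\<close>

text \<open>As a function of \<open>y\<close> this is the indicator of \<open>U\<close> smoothed over a length \<open>L\<close>; it is Lipschitz with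
constant \<open>1\<close>, since moving the window gains and loses at most the distance moved.\<close>

definition window :: "real set \<Rightarrow> real \<Rightarrow> real \<Rightarrow> real" where
  "window U y L = measure lborel (U \<inter> {y<..y + L})"

lemma fmeasurable_Ioc: "{a<..b :: real} \<in> fmeasurable lborel"
  by (cases "a \<le> b") (auto simp: fmeasurable_def)

lemma window_fmeasurable: "U \<in> sets borel \<Longrightarrow> U \<inter> {y<..y + L :: real} \<in> fmeasurable lborel"
  by (rule fmeasurableI2[OF fmeasurable_Ioc[of y "y + L"]]) auto

lemma measure_le_plus_Ioc:
  assumes "A \<in> fmeasurable lborel" "B \<in> fmeasurable lborel" "A \<subseteq> B \<union> {a<..b :: real}" "a \<le> b"
  shows "measure lborel A \<le> measure lborel B + (b - a)"
proof -
  have "measure lborel A \<le> measure lborel (B \<union> {a<..b})"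
    using assms fmeasurable_Ioc by (intro measure_mono_fmeasurable fmeasurable.Un) auto
  also have "\<dots> \<le> measure lborel B + measure lborel {a<..b}"
    using assms fmeasurable_Ioc[of a b] by (intro measure_Un_le) (auto simp: fmeasurable_def)
  finally show ?thesis using assms by simp
qed

lemma window_bounds:
  assumes "U \<in> sets borel" "0 \<le> L" shows "0 \<le> window U y L" "window U y L \<le> L"
  using measure_le_plus_Ioc[of "U \<inter> {y<..y + L}" "{}" y "y + L"] window_fmeasurable[OF assms(1)] assms
  by (auto simp: window_def)

lemma window_lip:
  assumes U: "U \<in> sets borel" and L: "0 \<le> L"
  shows "\<bar>window U y L - window U z L\<bar> \<le> \<bar>y - z\<bar>"
proof -
  have "window U y L \<le> window U z L + (z - y)" "window U z L \<le> window U y L + (z - y)" if "y \<le> z" for y z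
    unfolding window_def
    subgoal using that L by (intro measure_le_plus_Ioc window_fmeasurable U) auto
    subgoal using that L measure_le_plus_Ioc[of "U \<inter> {z<..z + L}" "U \<inter> {y<..y + L}" "y + L" "z + L"]
        window_fmeasurable[OF U] by fastforce
    done
  from this[of y z] this[of z y] show ?thesis by linarith
qed

lemma window_add:
  assumes U: "U \<in> sets borel" and L: "0 \<le> L" "0 \<le> L'"
  shows "window U y (L + L') = window U y L + window U (y + L) L'"
proof -
  have "U \<inter> {y<..y + (L + L')} = (U \<inter> {y<..y + L}) \<union> (U \<inter> {y + L<..y + L + L'})"
    using L by auto
  then show ?thesis unfolding window_def
    using window_fmeasurable[OF U, THEN fmeasurableD2] U by (simp only:) (rule measure_Union; auto)
qed

lemma window_translate:
  assumes [measurable]: "U \<in> sets borel" "V \<in> sets borel"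
    and ae: "AE y in lborel. y + r \<in> U \<longleftrightarrow> y \<in> V"
  shows "window U (y + r) L = window V y L"
proof -
  have tr: "(+) r \<in> lborel \<rightarrow>\<^sub>M borel" by simp
  have "window U (y + r) L = measure (distr lborel borel ((+) r)) (U \<inter> {y + r<..y + r + L})"
    by (simp add: window_def lborel_distr_plus)
  also have "\<dots> = measure lborel ((+) r -` (U \<inter> {y + r<..y + r + L}))"
    using measure_distr[OF tr, of "U \<inter> {y + r<..y + r + L}"] by simp
  also have "\<dots> = window V y L"
    unfolding window_def
  proof (rule measure_eq_AE)
    show "AE x in lborel. x \<in> (+) r -` (U \<inter> {y + r<..y + r + L}) \<longleftrightarrow> x \<in> V \<inter> {y<..y + L}"
      using ae by eventually_elim (auto simp: add.commute)
    have "(+) r -` (U \<inter> {y + r<..y + r + L}) \<inter> space borel \<in> sets borel"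
      by (rule measurable_sets[of "(+) r" borel borel]) auto
    then show "(+) r -` (U \<inter> {y + r<..y + r + L}) \<in> sets lborel" by simp
  qed auto
  finally show ?thesis .
qed

text \<open>If \<open>U\<close> has the same density \<open>c > 0\<close> in all intervals, then Lebesgue measure restricted to \<open>U\<close> and divided
by \<open>c\<close> is Lebesgue measure again, which therefore does not charge the complement of \<open>U\<close>.\<close>

lemma window_proportional_trivial:
  assumes U [measurable]: "U \<in> sets borel" and c: "\<And>y L. 0 \<le> L \<Longrightarrow> window U y L = c * L"
  shows "(AE y in lborel. y \<notin> U) \<or> (AE y in lborel. y \<in> U)"
proof -
  have em: "emeasure lborel (U \<inter> {y<..y + L}) = ennreal (c * L)" if "0 \<le> L" for y L
    using c[OF that, of y] window_fmeasurable[OF U, of y L]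
    by (simp add: window_def emeasure_eq_measure2)
  have "0 \<le> c" using window_bounds(1)[OF U, of 1 0] c[of 1 0] by simp
  then consider "c = 0" | "0 < c" by linarith
  then show ?thesis
  proof cases
    case 1
    have "U \<inter> {- real n<..- real n + 2 * real n} \<in> null_sets lborel" for n
      using em[of "2 * real n" "- real n"] 1 by auto
    then have "(\<Union>n. U \<inter> {- real n<..- real n + 2 * real n}) \<in> null_sets lborel"
      by (intro null_sets_UN) auto
    moreover have "(\<Union>n. U \<inter> {- real n<..- real n + 2 * real n}) = U"
    proof -
      have "\<exists>n. - real n < x \<and> x \<le> - real n + 2 * real n" for x
        using reals_Archimedean2[of "\<bar>x\<bar>"] by (metis abs_less_iff add.commute add_uminus_conv_diff
            less_eq_real_def minus_less_iff mult_2 add_diff_cancel)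
      then show ?thesis by auto
    qed
    ultimately show ?thesis by (intro disjI1) (auto intro: AE_not_in)
  next
    case 2
    define M where "M = density lborel (\<lambda>x. ennreal (indicator U x / c))"
    have "lborel = M"
    proof (rule lborel_eqI)
      fix l u :: real assume "\<And>b. b \<in> Basis \<Longrightarrow> l \<bullet> b \<le> u \<bullet> b"
      then have lu: "l \<le> u" by simp
      have "emeasure M (box l u) = (\<integral>\<^sup>+x. ennreal (1 / c) * indicator (U \<inter> {l<..<u}) x \<partial>lborel)"
        unfolding M_def by (subst emeasure_density)
          (auto intro!: nn_integral_cong simp: box_real split: split_indicator)
      also have "\<dots> = ennreal (1 / c) * emeasure lborel (U \<inter> {l<..<u})"
        by (simp add: nn_integral_cmult_indicator)
      also have "emeasure lborel (U \<inter> {l<..<u}) = emeasure lborel (U \<inter> {l<..l + (u - l)})"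
      proof (rule emeasure_eq_AE)
        show "AE x in lborel. x \<in> U \<inter> {l<..<u} \<longleftrightarrow> x \<in> U \<inter> {l<..l + (u - l)}"
          using AE_lborel_singleton[of u] by eventually_elim auto
      qed auto
      also have "\<dots> = ennreal (c * (u - l))" using lu by (intro em) simp
      finally show "emeasure M (box l u) = (\<Prod>b\<in>Basis. (u - l) \<bullet> b)"
        using 2 lu by (simp add: ennreal_mult'[symmetric])
    qed (simp add: M_def)
    moreover have "emeasure M (- U) = 0"
      unfolding M_def by (subst emeasure_density) (auto simp: nn_integral_0_iff_AE split: split_indicator)
    ultimately have "- U \<in> null_sets lborel" by auto
    then show ?thesis by (intro disjI2) (auto dest: AE_not_in)
  qed
qed

lemma additive_nonneg_linear:
  fixes c :: "real \<Rightarrow> real"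
  assumes add: "\<And>x y. 0 \<le> x \<Longrightarrow> 0 \<le> y \<Longrightarrow> c (x + y) = c x + c y"
    and nn: "\<And>x. 0 \<le> x \<Longrightarrow> 0 \<le> c x" and x: "0 \<le> x"
  shows "c x = c 1 * x"
proof -
  have c0: "c 0 = 0" using add[of 0 0] by simp
  have mul: "c (real n * y) = real n * c y" if "0 \<le> y" for n y
    using that by (induction n) (auto simp: c0 add algebra_simps)
  have mono: "c y \<le> c z" if "0 \<le> y" "y \<le> z" for y z
    using add[of y "z - y"] nn[of "z - y"] that by simp
  have "\<bar>c x - c 1 * x\<bar> \<le> c 1 / real (Suc n)" for n
  proof -
    define N where "N = real (Suc n)"
    have N: "0 < N" by (simp add: N_def)
    \<comment> \<open>Compare \<open>N * x\<close> with the neighbouring integers, where \<open>c\<close> is known by additivity.\<close>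
    define m where "m = nat \<lfloor>N * x\<rfloor>"
    have m: "real m \<le> N * x" "N * x \<le> real m + 1"
      using N x by (simp_all add: m_def)
    have "c (real m * 1) \<le> c (N * x)" "c (N * x) \<le> c (real (Suc m) * 1)"
      using m N x by (auto intro!: mono)
    then have "real m * c 1 \<le> N * c x" "N * c x \<le> (real m + 1) * c 1"
      using mul[of 1 m] mul[of 1 "Suc m"] mul[of x "Suc n"] x by (simp_all add: N_def algebra_simps)
    moreover have "real m * c 1 \<le> (N * x) * c 1" "(N * x) * c 1 \<le> (real m + 1) * c 1"
      using m nn[of 1] by (auto intro: mult_right_mono)
    ultimately have "\<bar>N * c x - (N * x) * c 1\<bar> \<le> c 1" by (simp add: algebra_simps)
    also have "N * c x - (N * x) * c 1 = N * (c x - c 1 * x)" by (simp add: algebra_simps)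
    finally have "\<bar>c x - c 1 * x\<bar> * N \<le> c 1" using N by (simp add: abs_mult mult.commute)
    then have "\<bar>c x - c 1 * x\<bar> \<le> c 1 / N" using N by (simp add: pos_le_divide_eq)
    then show ?thesis by (simp add: N_def)
  qed
  moreover have "(\<lambda>n. c 1 / real (Suc n)) \<longlonglongrightarrow> 0" by (rule LIMSEQ_Suc[OF lim_const_over_n])
  ultimately have "\<bar>c x - c 1 * x\<bar> \<le> 0" by (intro LIMSEQ_le_const) auto
  then show ?thesis by simp
qed

context positive_factors
begin

text \<open>For almost every \<open>w\<close> the windows of the fibre over \<open>w\<close> have a measure that depends on neither \<open>w\<close>
nor their position. This measure is additive in the length of the window, hence proportional to it,
with a factor common to all \<open>w\<close>.\<close>

lemma invariant_sets_trivial: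
  fixes A :: "((int \<Rightarrow> bool) \<times> real) set"
  assumes ab: "abundant l" and A: "A \<in> sets (X \<Otimes>\<^sub>M borel)"
    and inv: "\<And>k. AE w in X. AE y in lborel. (w(k := True), y + l k) \<in> A \<longleftrightarrow> (w(k := False), y) \<in> A"
  shows "(AE w in X. AE y in lborel. (w, y) \<notin> A) \<or> (AE w in X. AE y in lborel. (w, y) \<in> A)"
proof -
  define U where "U w = Pair w -` A" for w
  have U [measurable]: "U w \<in> sets borel" for w unfolding U_def by (rule sets_Pair1[OF A])
  \<comment> \<open>The divisor makes \<open>G L\<close> bounded by one and keeps the Lipschitz constant at most one.\<close>
  define G where "G L w y = window (U w) y L / (L + 1)" for L w y
  have wm [measurable]: "(\<lambda>w. window (U w) y L) \<in> borel_measurable X" for y L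
  proof -
    have "(\<lambda>w. emeasure lborel (Pair w -` (A \<inter> UNIV \<times> {y<..y + L}))) \<in> borel_measurable X"
      by (rule lborel.measurable_emeasure_Pair)
         (use A in \<open>auto intro!: sets.Int pair_measureI simp: sets_pair_measure_cong[OF refl sets_lborel]
            sets.top[of X, simplified]\<close>)
    moreover have "Pair w -` (A \<inter> UNIV \<times> {y<..y + L}) = U w \<inter> {y<..y + L}" for w
      by (auto simp: U_def)
    ultimately show ?thesis by (simp add: window_def measure_def)
  qed
  have lip: "lipschitz_family (G L)" if L: "0 \<le> L" for L
  proof -
    have "\<bar>G L w y - G L w z\<bar> \<le> \<bar>y - z\<bar>" for w y z
    proof -
      have "\<bar>G L w y - G L w z\<bar> = \<bar>window (U w) y L - window (U w) z L\<bar> / (L + 1)"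
        using L by (simp add: G_def diff_divide_distrib[symmetric])
      also have "\<dots> \<le> \<bar>window (U w) y L - window (U w) z L\<bar> / 1"
        using L by (intro divide_left_mono) auto
      finally show ?thesis using window_lip[OF U L, of w y z] by simp
    qed
    then show ?thesis unfolding lipschitz_family_def
      using L window_bounds[OF U L] by (auto simp: G_def intro: order_trans[OF window_bounds(2)[OF U L]])
  qed
  have Ginv: "flip_inv l k (G L)" for k L
    unfolding flip_inv_def using inv[of k]
  proof eventually_elim
    case (elim w)
    have "window (U (w(k := True))) (y + l k) L = window (U (w(k := False))) y L" for y
      using elim by (intro window_translate U) (auto simp: U_def)
    then show ?case by (simp add: G_def)
  qed
  define c where "c L = (\<integral>w. window (U w) 0 L \<partial>X)" for L
  have wi: "integrable X (\<lambda>w. window (U w) y L)" if "0 \<le> L" for y L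
    using window_bounds[OF U that] by (intro X.integrable_const_bound[where B=L]) auto
  have mG: "mean (G L) y = (\<integral>w. window (U w) y L \<partial>X) / (L + 1)" if "0 \<le> L" for y L
    by (simp add: mean_def G_def)
  have cy: "(\<integral>w. window (U w) y L \<partial>X) = c L" if L: "0 \<le> L" for y L
    using mean_translate[OF ab lip[OF L], of "{}" y 0] Ginv L by (simp add: mG c_def)
  have cadd: "c (x + y) = c x + c y" if xy: "0 \<le> x" "0 \<le> y" for x y
  proof -
    have "c (x + y) = (\<integral>w. window (U w) 0 x + window (U w) (0 + x) y \<partial>X)"
      unfolding c_def using xy by (simp add: window_add)
    also have "\<dots> = c x + c y" using xy wi cy by simp
    finally show ?thesis .
  qed
  have cnn: "0 \<le> c x" if "0 \<le> x" for x
    unfolding c_def using window_bounds[OF U that] by (intro Bochner_Integration.integral_nonneg)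
  have clin: "c L = c 1 * L" if "0 \<le> L" for L
    by (rule additive_nonneg_linear[OF cadd cnn that])
  have "AE w in X. window (U w) y L = c 1 * L" if L: "0 \<le> L" for y L
  proof -
    have "cofinitely_inv l (G L)" unfolding cofinitely_inv_def using lip[OF L] Ginv by (intro conjI exI[of _ "{}"]) auto
    from cofinitely_inv_AE_const[OF ab this, of y] show ?thesis
      by eventually_elim (use L mG[OF L, of y] cy[OF L, of y] clin[OF L] in \<open>auto simp: G_def\<close>)
  qed
  then have "AE w in X. \<forall>q r :: rat. 0 \<le> r \<longrightarrow> window (U w) (of_rat q) (of_rat r) = c 1 * of_rat r"
    unfolding AE_all_countable by (auto simp: AE_conj_iff)
  then have aell: "AE w in X. \<forall>y L. 0 \<le> L \<longrightarrow> window (U w) y L = c 1 * L"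
  proof eventually_elim
    case (elim w)
    have "window (U w) y L = c 1 * L" if L: "0 \<le> L" for y L
    proof -
      have "\<bar>window (U w) y L - c 1 * L\<bar> \<le> 0 + e" if e: "0 < e" for e
      proof -
        define \<delta> where "\<delta> = e / (3 + c 1)"
        have c1: "0 \<le> c 1" by (rule cnn) simp
        have \<delta>: "0 < \<delta>" using e c1 by (simp add: \<delta>_def)
        obtain q where q: "y < of_rat q" "of_rat q < y + \<delta>" using of_rat_dense[of y "y + \<delta>"] \<delta> by auto
        obtain r where r: "L < of_rat r" "of_rat r < L + \<delta>" using of_rat_dense[of L "L + \<delta>"] \<delta> by auto
        define q' r' :: real where "q' = of_rat q" and "r' = of_rat r"
        have "0 < r'" using r(1) L unfolding r'_def by linarith
        then have "0 \<le> r" by (simp add: r'_def)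
        then have w: "window (U w) q' r' = c 1 * r'" using elim by (simp add: q'_def r'_def)
        have "\<bar>window (U w) y r' - window (U w) q' r'\<bar> \<le> \<delta>"
          using window_lip[OF U, of r' w y q'] q \<open>0 < r'\<close> unfolding q'_def by linarith
        moreover have "window (U w) y r' = window (U w) y L + window (U w) (y + L) (r' - L)"
          using window_add[OF U L, of "r' - L" w y] r by (simp add: r'_def)
        moreover have "0 \<le> window (U w) (y + L) (r' - L)" "window (U w) (y + L) (r' - L) \<le> \<delta>"
          using window_bounds[OF U, of "r' - L" w "y + L"] r by (auto simp: r'_def)
        moreover have "c 1 * L \<le> c 1 * r'" "c 1 * r' \<le> c 1 * L + c 1 * \<delta>"
          using r c1 by (auto simp: r'_def distrib_left[symmetric] intro!: mult_left_mono)
        ultimately have "\<bar>window (U w) y L - c 1 * L\<bar> \<le> 3 * \<delta> + c 1 * \<delta>" using w \<delta> by linarith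
        also have "\<dots> = (3 + c 1) * \<delta>" by (simp add: distrib_right)
        also have "\<dots> = e" using c1 by (simp add: \<delta>_def)
        finally show ?thesis by simp
      qed
      then have "\<bar>window (U w) y L - c 1 * L\<bar> \<le> 0" by (rule field_le_epsilon)
      then show ?thesis by simp
    qed
    then show ?case by blast
  qed
  show ?thesis
  proof (cases "c 1 = 0")
    case True
    from aell have "AE w in X. AE y in lborel. y \<notin> U w"
    proof eventually_elim
      case (elim w)
      then have w0: "window (U w) y L = 0" if "0 \<le> L" for y L using that True by simp
      have "(AE y in lborel. y \<notin> U w) \<or> (AE y in lborel. y \<in> U w)"
        using w0 by (intro window_proportional_trivial[OF U, of w 0]) auto
      then show ?case
      proof (elim disjE)
        assume "AE y in lborel. y \<in> U w"
        then have "window (U w) 0 1 = measure lborel {0<..1::real}"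
          unfolding window_def by (intro measure_eq_AE) auto
        then show ?thesis using w0[of 1 0] by simp
      qed auto
    qed
    then show ?thesis by (auto simp: U_def)
  next
    case False
    from aell have "AE w in X. AE y in lborel. y \<in> U w"
    proof eventually_elim
      case (elim w)
      have "(AE y in lborel. y \<notin> U w) \<or> (AE y in lborel. y \<in> U w)"
        using elim by (intro window_proportional_trivial[OF U, of w "c 1"]) auto
      then show ?case
      proof (elim disjE)
        assume "AE y in lborel. y \<notin> U w"
        then have "window (U w) 0 1 = measure lborel ({} :: real set)"
          unfolding window_def by (intro measure_eq_AE) auto
        then show ?thesis using elim False by simp
      qed auto
    qed
    then show ?thesis by (auto simp: U_def)
  qed
qed

end

section \<open>Absolute continuity of the stationary product\<close>

definition determined_by :: "int set \<Rightarrow> (int \<Rightarrow> bool) set \<Rightarrow> bool" where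
  "determined_by J A \<longleftrightarrow> (\<forall>w v. (\<forall>j\<in>J. w j = v j) \<longrightarrow> (w \<in> A \<longleftrightarrow> v \<in> A))"

context bernoulli_factors
begin

text \<open>The sets that can be approximated by events about finitely many coordinates form a
\<open>\<sigma>\<close>-algebra. The approximation is required for two measures at once, because an absolute
continuity statement compares both on the same approximating set.\<close>

lemma cylinder_approximation:
  assumes M: "finite_measure M" "sets M = sets X" and N: "finite_measure N" "sets N = sets X"
    and E: "E \<in> sets X" and "0 < e"
  shows "\<exists>J A. finite J \<and> A \<in> sets X \<and> determined_by J A \<and>
    measure M (sym_diff E A) + measure N (sym_diff E A) < e"
proof -
  interpret M: finite_measure M by fact
  interpret N: finite_measure N by fact
  define m where "m S = measure M S + measure N S" for S
  have m_Un: "m S \<le> m S1 + m S2" if "S \<subseteq> S1 \<union> S2" "S1 \<in> sets X" "S2 \<in> sets X" for S S1 S2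
  proof -
    have "measure M S \<le> measure M S1 + measure M S2" "measure N S \<le> measure N S1 + measure N S2"
      using that M(2) N(2)
      by (auto intro!: order_trans[OF M.finite_measure_mono measure_Un_le]
          order_trans[OF N.finite_measure_mono measure_Un_le])
    then show ?thesis by (simp add: m_def)
  qed
  define Q where "Q E \<longleftrightarrow> (\<forall>e>0. \<exists>J A. finite J \<and> A \<in> sets X \<and> determined_by J A \<and> m (sym_diff E A) < e)" for E
  have Un: "Q (E1 \<union> E2)" if Q: "Q E1" "Q E2" and [measurable]: "E1 \<in> sets X" "E2 \<in> sets X" for E1 E2
    unfolding Q_def
  proof (intro allI impI)
    fix e :: real assume "0 < e"
    then have "0 < e / 2" by simp
    then obtain J1 A1 J2 A2 where 1: "finite J1" "determined_by J1 A1" "m (sym_diff E1 A1) < e / 2"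
      and 2: "finite J2" "determined_by J2 A2" "m (sym_diff E2 A2) < e / 2"
      and [measurable]: "A1 \<in> sets X" "A2 \<in> sets X"
      using Q unfolding Q_def by metis
    have "m (sym_diff (E1 \<union> E2) (A1 \<union> A2)) \<le> m (sym_diff E1 A1) + m (sym_diff E2 A2)"
      by (rule m_Un) auto
    moreover have "determined_by (J1 \<union> J2) (A1 \<union> A2)"
      using 1(2) 2(2) unfolding determined_by_def by blast
    ultimately show "\<exists>J A. finite J \<and> A \<in> sets X \<and> determined_by J A \<and> m (sym_diff (E1 \<union> E2) A) < e"
      using 1 2 by (intro exI[of _ "J1 \<union> J2"] exI[of _ "A1 \<union> A2"]) auto
  qed
  have empty: "Q {}"
    unfolding Q_def by (auto intro!: exI[of _ "{}"] simp: m_def determined_by_def)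
  let ?G = "{{f \<in> \<Pi>\<^sub>E i\<in>UNIV. space (P i). f i \<in> A} | i A. i \<in> UNIV \<and> A \<in> sets (P i)}"
  have "E \<in> sigma_sets (\<Pi>\<^sub>E i\<in>UNIV. space (P i)) ?G"
    using E by (simp add: sets_PiM_single)
  then have "Q E \<and> E \<in> sets X"
  proof (induction rule: sigma_sets.induct)
    case (Basic a)
    then obtain i A where a: "a = {w. w i \<in> A}" by auto
    have "{w \<in> space X. w i \<in> A} \<in> sets X" by measurable
    then have aX: "a \<in> sets X" by (simp add: a)
    moreover have "Q a" unfolding Q_def
    proof (intro allI impI exI conjI)
      show "finite {i}" by simp
      show "a \<in> sets X" by (rule aX)
      show "determined_by {i} a" by (auto simp: determined_by_def a)
    qed (simp add: m_def)
    ultimately show ?case by simp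
  next
    case Empty
    then show ?case using empty by simp
  next
    case (Compl a)
    have sd: "sym_diff (- a) (- A) = sym_diff a A" for A by auto
    have "Q (- a)" unfolding Q_def
    proof (intro allI impI)
      fix e :: real assume "0 < e"
      then obtain J A where J: "finite J" "A \<in> sets X" "determined_by J A" "m (sym_diff a A) < e"
        using Compl.IH unfolding Q_def by metis
      have "- A \<in> sets X" using sets.compl_sets[OF J(2)] by (simp add: Compl_eq_Diff_UNIV)
      moreover have "determined_by J (- A)" using J(3) by (auto simp: determined_by_def)
      ultimately show "\<exists>J A. finite J \<and> A \<in> sets X \<and> determined_by J A \<and> m (sym_diff (- a) A) < e"
        using J sd[of A] by (intro exI[of _ J] exI[of _ "- A"]) auto
    qed
    moreover have "- a \<in> sets X" using sets.compl_sets[of a X] Compl.IH by (simp add: Compl_eq_Diff_UNIV)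
    ultimately show ?case by (simp add: Compl_eq_Diff_UNIV[symmetric])
  next
    case (Union a)
    then have [measurable]: "a i \<in> sets X" and Qa: "Q (a i)" for i by auto
    define b where "b n = (\<Union>i<n. a i)" for n :: nat
    have [measurable]: "b n \<in> sets X" for n unfolding b_def by measurable
    have Qb: "Q (b n)" for n
    proof (induction n)
      case 0 then show ?case using empty by (simp add: b_def)
    next
      case (Suc n)
      have "b (Suc n) = b n \<union> a n" by (auto simp: b_def less_Suc_eq)
      then show ?case using Un[OF Suc.IH Qa] by simp
    qed
    have inc: "incseq b" unfolding b_def incseq_def by force
    have bU: "(\<Union>n. b n) = (\<Union>i. a i)" unfolding b_def by auto
    have bsub: "b n \<subseteq> (\<Union>i. a i)" for n by (auto simp: b_def)
    have "b n \<in> sets X" for n by measurable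
    then have rngM: "range b \<subseteq> sets M" and rngN: "range b \<subseteq> sets N"
      unfolding M(2) N(2) by blast+
    have "(\<lambda>n. measure M (b n)) \<longlonglongrightarrow> measure M (\<Union>n. b n)" "(\<lambda>n. measure N (b n)) \<longlonglongrightarrow> measure N (\<Union>n. b n)"
      by (rule M.finite_Lim_measure_incseq[OF rngM inc], rule N.finite_Lim_measure_incseq[OF rngN inc])
    then have "(\<lambda>n. (measure M (\<Union>i. a i) - measure M (b n)) + (measure N (\<Union>i. a i) - measure N (b n))) \<longlonglongrightarrow>
        (measure M (\<Union>i. a i) - measure M (\<Union>i. a i)) + (measure N (\<Union>i. a i) - measure N (\<Union>i. a i))"
      unfolding bU by (intro tendsto_intros)
    moreover have "m ((\<Union>i. a i) - b n) = (measure M (\<Union>i. a i) - measure M (b n)) + (measure N (\<Union>i. a i) - measure N (b n))" for n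
      unfolding m_def using bsub[of n] M(2) N(2)
      by (subst M.finite_measure_Diff, simp_all, subst N.finite_measure_Diff, simp_all)
    ultimately have lim: "(\<lambda>n. m ((\<Union>i. a i) - b n)) \<longlonglongrightarrow> 0" by simp
    have "Q (\<Union>i. a i)" unfolding Q_def
    proof (intro allI impI)
      fix e :: real assume e: "0 < e"
      then have "eventually (\<lambda>n. m ((\<Union>i. a i) - b n) < e / 2) sequentially"
        by (intro order_tendstoD(2)[OF lim]) simp
      then obtain n where n: "m ((\<Union>i. a i) - b n) < e / 2" by (auto simp: eventually_sequentially)
      obtain J A where J: "finite J" "determined_by J A" "m (sym_diff (b n) A) < e / 2" and [measurable]: "A \<in> sets X"
        using Qb[of n] e unfolding Q_def by (metis half_gt_zero)
      have "m (sym_diff (\<Union>i. a i) A) \<le> m ((\<Union>i. a i) - b n) + m (sym_diff (b n) A)"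
        using bsub[of n] by (intro m_Un) auto
      then show "\<exists>J A. finite J \<and> A \<in> sets X \<and> determined_by J A \<and> m (sym_diff (\<Union>i. a i) A) < e"
        using J n by (intro exI[of _ J] exI[of _ A]) auto
    qed
    then show ?case by auto
  qed
  then show ?thesis using \<open>0 < e\<close> unfolding Q_def m_def by blast
qed

end

lemma weighted_Cauchy_Schwarz:
  fixes p1 p2 :: real
  assumes "0 < p1" "0 < p2"
  shows "(n1 * x1 + n2 * x2)\<^sup>2 \<le> (n1\<^sup>2 / p1 + n2\<^sup>2 / p2) * (p1 * x1\<^sup>2 + p2 * x2\<^sup>2)"
proof -
  have "(n1\<^sup>2 / p1 + n2\<^sup>2 / p2) * (p1 * x1\<^sup>2 + p2 * x2\<^sup>2) - (n1 * x1 + n2 * x2)\<^sup>2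
      = (n1 * p2 * x2 - n2 * p1 * x1)\<^sup>2 / (p1 * p2)"
    using assms by (simp add: field_simps power2_eq_square)
  moreover have "0 \<le> (n1 * p2 * x2 - n2 * p1 * x1)\<^sup>2 / (p1 * p2)" using assms by simp
  ultimately show ?thesis by linarith
qed

locale half_stationary_factors = positive_factors +
  assumes stationary: "\<And>k a. k \<le> 0 \<Longrightarrow> wt k a = wt 0 a"
begin

abbreviation B where "B \<equiv> PiM UNIV (\<lambda>_ :: int. P 0)"

sublocale B: bernoulli_factors "\<lambda>_. P 0"
  by (rule bernoulli_factors.intro) (rule prob_P sets_P)+

lemma B_wt: "B.wt k a = wt 0 a"
  by (simp add: B.wt_def wt_def)

lemma sets_B: "sets B = sets X"
  by (rule sets_PiM_cong) (simp_all add: sets_P)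

text \<open>The second moment under \<open>P\<^sub>k\<close> of the density of \<open>P\<^sub>0\<close> with respect to \<open>P\<^sub>k\<close>.\<close>

definition chi :: "int \<Rightarrow> real" where
  "chi k = (wt 0 True)\<^sup>2 / wt k True + (wt 0 False)\<^sup>2 / wt k False"

text \<open>This is the Cauchy-Schwarz inequality for the density of the stationary product on the coordinates in
\<open>J\<close>, applied to one coordinate at a time so that the density need not be formed.\<close>

lemma cylinder_L2_bound:
  assumes "finite J"
  shows "u \<in> borel_measurable X \<Longrightarrow> (\<And>w. \<bar>u w\<bar> \<le> (1::real)) \<Longrightarrow>
    (\<And>w v. (\<forall>j\<in>J. w j = v j) \<Longrightarrow> u w = u v) \<Longrightarrow>
    (\<integral>w. u w \<partial>B)\<^sup>2 \<le> (\<Prod>k\<in>J. chi k) * (\<integral>w. (u w)\<^sup>2 \<partial>X)"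
  using assms
proof (induction J arbitrary: u rule: finite_induct)
  case empty
  obtain c where u: "u = (\<lambda>w. c)" using empty.prems(3) by blast
  show ?case using B.X.prob_space X.prob_space by (simp add: u)
next
  case (insert k J)
  have [measurable]: "u \<in> borel_measurable X" by fact
  have [measurable]: "u \<in> borel_measurable B"
    using insert.prems(1) by (simp cong: measurable_cong_sets add: sets_B measurable_cong_sets[OF sets_B refl])
  define n p where "n = wt 0" and "p = wt k"
  have p: "0 < p a" for a by (simp add: p_def wt_pos)
  define x where "x a = (\<integral>w. u (w(k := a)) \<partial>B)" for a
  define y where "y a = (\<integral>w. (u (w(k := a)))\<^sup>2 \<partial>X)" for a
  define C where "C = (\<Prod>k\<in>J. chi k)"
  have chi: "0 \<le> chi k" for k unfolding chi_def using wt_pos by (intro add_nonneg_nonneg divide_nonneg_nonneg) (auto simp: less_imp_le)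
  have C: "0 \<le> C" unfolding C_def by (intro prod_nonneg) (simp add: chi)
  have IH: "(x a)\<^sup>2 \<le> C * y a" for a
    unfolding x_def y_def C_def
  proof (rule insert.IH)
    show "u (w(k := a)) = u (v(k := a))" if "\<forall>j\<in>J. w j = v j" for w v
      using that by (intro insert.prems(3)) auto
  qed (use insert.prems(2) measurable_compose[OF upd_measurable insert.prems(1)] in auto)
  have eqB: "(\<integral>w. u w \<partial>B) = n True * x True + n False * x False"
    unfolding x_def n_def using B.integral_resample[of u 1 k] insert.prems(2) by (simp only: B_wt) simp
  have eqX: "(\<integral>w. (u w)\<^sup>2 \<partial>X) = p True * y True + p False * y False"
    unfolding y_def p_def using insert.prems(2)
    by (intro integral_resample[where B=1]) (auto simp: abs_square_le_1)
  have "(n True * x True + n False * x False)\<^sup>2 \<le> chi k * (p True * (x True)\<^sup>2 + p False * (x False)\<^sup>2)"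
    unfolding chi_def n_def p_def by (intro weighted_Cauchy_Schwarz wt_pos)
  moreover have "chi k * (p True * (x True)\<^sup>2 + p False * (x False)\<^sup>2) \<le> chi k * (p True * (C * y True) + p False * (C * y False))"
    using IH p chi by (intro mult_left_mono add_mono) (auto simp: less_imp_le)
  moreover have "\<dots> = (\<Prod>k\<in>insert k J. chi k) * (p True * y True + p False * y False)"
    using insert.hyps by (simp add: C_def algebra_simps)
  ultimately show ?case unfolding eqB eqX by linarith
qed

definition dev :: "nat \<Rightarrow> real" where
  "dev n = wt (int n) False - wt 0 False"

lemma chi_eq: "chi k = 1 + (wt k False - wt 0 False)\<^sup>2 / (wt k True * wt k False)"
proof -
  have T: "wt k True = 1 - wt k False" "wt 0 True = 1 - wt 0 False" using wt_sum[of k] wt_sum[of 0] by auto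
  have "0 < 1 - wt k False" "0 < wt k False" using wt_pos[of k True] wt_pos[of k False] T by auto
  then show ?thesis unfolding chi_def T by (simp add: field_simps power2_eq_square)
qed

text \<open>The constants in the second-moment bound are partial products of \<open>1 + O((dev k)\<^sup>2)\<close>, so they stay below
some \<open>C\<close>. Then \<open>B(A)\<^sup>2 \<le> C X(A)\<close> for every event \<open>A\<close> about finitely many coordinates, and by
approximation null sets of \<open>X\<close> are null sets of \<open>B\<close>.\<close>

lemma absolutely_continuous_stationary_product:
  assumes sm: "summable (\<lambda>n. (dev n)\<^sup>2)"
  shows "absolutely_continuous X B"
proof -
  define z where "z k = (wt k False - wt 0 False)\<^sup>2 / (wt k True * wt k False)" for k
  have z: "0 \<le> z k" for k unfolding z_def by simp
  have zle: "0 \<le> k" if "z k \<noteq> 0" for k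
    using stationary[of k False] that by (cases "k \<le> 0") (auto simp: z_def)
  have "(\<lambda>n. (dev n)\<^sup>2) \<longlonglongrightarrow> 0" by (rule summable_LIMSEQ_zero[OF sm])
  then have "(\<lambda>n. sqrt ((dev n)\<^sup>2)) \<longlonglongrightarrow> sqrt 0" by (rule tendsto_real_sqrt)
  then have d0: "dev \<longlonglongrightarrow> 0" by (simp add: tendsto_rabs_zero_iff)
  have tend: "(\<lambda>n. (1 - (dev n + wt 0 False)) * (dev n + wt 0 False)) \<longlonglongrightarrow> (1 - (0 + wt 0 False)) * (0 + wt 0 False)"
    by (intro tendsto_intros d0)
  have eq1: "(1 - (dev n + wt 0 False)) * (dev n + wt 0 False) = wt (int n) True * wt (int n) False" for n
  proof -
    have "wt (int n) True = 1 - wt (int n) False" using wt_sum[of "int n"] by simp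
    then show ?thesis by (simp add: dev_def)
  qed
  have eq2: "(1 - (0 + wt 0 False)) * (0 + wt 0 False) = wt 0 True * wt 0 False"
  proof -
    have "wt 0 True = 1 - wt 0 False" using wt_sum[of 0] by simp
    then show ?thesis by simp
  qed
  have lim: "(\<lambda>n. wt (int n) True * wt (int n) False) \<longlonglongrightarrow> wt 0 True * wt 0 False"
    using tend unfolding eq1 eq2 .
  define c where "c = wt 0 True * wt 0 False / 2"
  have w: "0 < wt 0 True * wt 0 False" by (intro mult_pos_pos wt_pos)
  have c: "0 < c" "c < wt 0 True * wt 0 False" using w unfolding c_def by linarith+
  have "summable (\<lambda>n. z (int n))"
  proof (rule summable_comparison_test_ev)
    have "eventually (\<lambda>n. c < wt (int n) True * wt (int n) False) sequentially"
      using c by (intro order_tendstoD(1)[OF lim])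
    then show "eventually (\<lambda>n. norm (z (int n)) \<le> (dev n)\<^sup>2 / c) sequentially"
    proof eventually_elim
      case (elim n)
      then show ?case using c by (auto simp: z_def dev_def wt_pos intro!: divide_left_mono mult_pos_pos)
    qed
    show "summable (\<lambda>n. (dev n)\<^sup>2 / c)" using sm by (rule summable_divide)
  qed
  note zs = this
  define C where "C = exp (\<Sum>n. z (int n))"
  have prodC: "(\<Prod>k\<in>J. chi k) \<le> C" if J: "finite J" for J
  proof -
    have "(\<Prod>k\<in>J. chi k) \<le> (\<Prod>k\<in>J. exp (z k))"
      using z by (intro prod_mono) (auto simp: chi_eq z_def[symmetric] intro: add_nonneg_nonneg)
    also have "\<dots> = exp (\<Sum>k\<in>J. z k)" using J by (simp add: exp_sum)
    also have "(\<Sum>k\<in>J. z k) = (\<Sum>k\<in>{k\<in>J. 0 \<le> k}. z k)"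
      using J by (intro sum.mono_neutral_right) (auto dest: zle)
    also have "\<dots> = (\<Sum>n\<in>nat ` {k\<in>J. 0 \<le> k}. z (int n))"
      by (subst sum.reindex) (auto simp: inj_on_def)
    also have "\<dots> \<le> (\<Sum>n. z (int n))" using zs z J by (intro sum_le_suminf) auto
    finally show ?thesis by (simp add: C_def)
  qed
  have C: "0 < C" by (simp add: C_def)
  show ?thesis unfolding absolutely_continuous_def
  proof
    fix E assume "E \<in> null_sets X"
    then have E: "E \<in> sets X" "X.prob E = 0" by (auto simp: X.emeasure_eq_measure)
    have "B.X.prob E \<le> 0 + e" if e: "0 < e" for e
    proof -
      \<comment> \<open>The second bound gives \<open>C * X(A) \<le> (e / 2)\<^sup>2\<close> for the approximating event \<open>A\<close>.\<close>
      define \<delta> where "\<delta> = min (e / 2) (e\<^sup>2 / (4 * C))"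
      have \<delta>: "0 < \<delta>" "\<delta> \<le> e / 2" "\<delta> \<le> e\<^sup>2 / (4 * C)" using e C by (auto simp: \<delta>_def)
      obtain J A where J: "finite J" "determined_by J A" and [measurable]: "A \<in> sets X"
        and m: "X.prob (sym_diff E A) + B.X.prob (sym_diff E A) < \<delta>"
        using cylinder_approximation[OF X.finite_measure_axioms refl B.X.finite_measure_axioms sets_B E(1) \<delta>(1)] by blast
      have [measurable]: "A \<in> sets B" "E \<in> sets B" "E \<in> sets X" using E sets_B by auto
      have "X.prob A \<le> X.prob (E \<union> sym_diff E A)" by (intro X.finite_measure_mono) auto
      also have "\<dots> \<le> X.prob E + X.prob (sym_diff E A)" by (intro measure_Un_le) auto
      finally have XA: "X.prob A \<le> e\<^sup>2 / (4 * C)" using E m \<delta> measure_nonneg[of B "sym_diff E A"] by linarith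
      have "(\<integral>w. indicator A w \<partial>B)\<^sup>2 \<le> (\<Prod>k\<in>J. chi k) * (\<integral>w. (indicator A w)\<^sup>2 \<partial>X)"
      proof (rule cylinder_L2_bound[OF J(1)])
        show "indicator A w = (indicator A v :: real)" if "\<forall>j\<in>J. w j = v j" for w v
          using J(2) that by (auto simp: determined_by_def split: split_indicator)
      qed (auto split: split_indicator)
      also have "(\<lambda>w. (indicator A w :: real)\<^sup>2) = indicator A" by (auto split: split_indicator)
      finally have "(B.X.prob A)\<^sup>2 \<le> (\<Prod>k\<in>J. chi k) * X.prob A" by simp
      also have "\<dots> \<le> C * (e\<^sup>2 / (4 * C))" using prodC[OF J(1)] XA C by (intro mult_mono) auto
      also have "\<dots> = (e / 2)\<^sup>2" using C by (simp add: power2_eq_square)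
      finally have BA: "B.X.prob A \<le> e / 2" using e by (simp add: abs_le_square_iff[symmetric])
      have "B.X.prob E \<le> B.X.prob (A \<union> sym_diff E A)" by (intro B.X.finite_measure_mono) auto
      also have "\<dots> \<le> B.X.prob A + B.X.prob (sym_diff E A)" by (intro measure_Un_le) auto
      finally show ?thesis using BA m \<delta> measure_nonneg[of X "sym_diff E A"] by linarith
    qed
    then have "B.X.prob E \<le> 0" by (rule field_le_epsilon)
    then have "B.X.prob E = 0" using measure_nonneg[of B E] by linarith
    then show "E \<in> null_sets B" using E sets_B by (auto simp: B.X.emeasure_eq_measure null_sets_def)
  qed
qed

end

section \<open>Square summability of coordinate coefficients\<close>

context positive_factors
begin

definition centred :: "int \<Rightarrow> (int \<Rightarrow> bool) \<Rightarrow> real" where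
  "centred k w = (if w k then 0 else 1) - wt k False"

lemma centred_measurable [measurable]: "centred k \<in> borel_measurable X"
  unfolding centred_def by measurable

lemma wt_less_1: "wt k a < 1"
  using wt_sum[of k] wt_pos[of k True] wt_pos[of k False] by (cases a) auto

lemma centred_bound: "\<bar>centred k w\<bar> \<le> 1"
  using wt_less_1[of k False] wt_pos[of k False] by (auto simp: centred_def)

lemma centred_orthogonal:
  assumes "j \<noteq> k" shows "(\<integral>w. centred j w * centred k w \<partial>X) = 0"
proof -
  have "(\<integral>w. centred j w * centred k w \<partial>X) = wt k True * (\<integral>w. centred j (w(k := True)) * centred k (w(k := True)) \<partial>X)
    + wt k False * (\<integral>w. centred j (w(k := False)) * centred k (w(k := False)) \<partial>X)"
    using centred_bound by (intro integral_resample[where B=1]) (auto simp: abs_mult intro!: mult_le_one)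
  also have "\<dots> = wt k True * (- wt k False * (\<integral>w. centred j w \<partial>X)) + wt k False * (wt k True * (\<integral>w. centred j w \<partial>X))"
  proof -
    have "centred j (w(k := a)) = centred j w" "centred k (w(k := True)) = - wt k False"
      "centred k (w(k := False)) = wt k True" for w a
      using assms wt_sum[of k] by (auto simp: centred_def)
    then show ?thesis by (simp add: mult.commute)
  qed
  finally show ?thesis by simp
qed

text \<open>Bessel's inequality: the centred coordinates are orthogonal, of norm at most one.\<close>

lemma centred_bessel:
  fixes b :: "_ \<Rightarrow> real"
  assumes J: "finite J" and [measurable]: "b \<in> borel_measurable X" and b: "\<And>w. \<bar>b w\<bar> \<le> M"
  shows "(\<Sum>k\<in>J. (\<integral>w. b w * centred k w \<partial>X)\<^sup>2) \<le> M\<^sup>2"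
proof -
  define c where "c k = (\<integral>w. b w * centred k w \<partial>X)" for k
  define s where "s w = (\<Sum>k\<in>J. c k * centred k w)" for w
  have M: "0 \<le> M" using b[of undefined] by simp
  have [measurable]: "s \<in> borel_measurable X" unfolding s_def by measurable
  have bc: "\<bar>b w * centred k w\<bar> \<le> M" for k w
    using mult_mono[OF b[of w] centred_bound[of k w]] M by (simp add: abs_mult)
  have ibc: "integrable X (\<lambda>w. b w * centred k w)" for k
    using bc by (intro X.integrable_const_bound[where B=M]) auto
  have icc: "integrable X (\<lambda>w. centred j w * centred k w)" for j k
    using mult_mono[OF centred_bound[of j] centred_bound[of k]]
    by (intro X.integrable_const_bound[where B=1]) (auto simp: abs_mult)
  have bb: "(b w)\<^sup>2 \<le> M\<^sup>2" for w using b[of w] by (simp add: abs_le_square_iff[symmetric])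
  have ibb: "integrable X (\<lambda>w. (b w)\<^sup>2)"
    using bb by (intro X.integrable_const_bound[where B="M\<^sup>2"]) auto
  have sb: "(\<lambda>w. b w * s w) = (\<lambda>w. \<Sum>k\<in>J. c k * (b w * centred k w))"
    by (auto simp: s_def sum_distrib_left mult_ac)
  have ss: "(\<lambda>w. (s w)\<^sup>2) = (\<lambda>w. \<Sum>j\<in>J. \<Sum>k\<in>J. (c j * c k) * (centred j w * centred k w))"
    by (auto simp: s_def power2_eq_square sum_product mult_ac)
  have isb: "integrable X (\<lambda>w. b w * s w)" unfolding sb using ibc by (intro Bochner_Integration.integrable_sum) auto
  have iss: "integrable X (\<lambda>w. (s w)\<^sup>2)" unfolding ss using icc by (intro Bochner_Integration.integrable_sum) auto
  have 1: "(\<integral>w. b w * s w \<partial>X) = (\<Sum>k\<in>J. (c k)\<^sup>2)"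
    unfolding sb using ibc by (simp add: c_def[symmetric] power2_eq_square)
  have "(\<integral>w. (s w)\<^sup>2 \<partial>X) = (\<Sum>j\<in>J. \<Sum>k\<in>J. (c j * c k) * (\<integral>w. centred j w * centred k w \<partial>X))"
    unfolding ss using icc by simp
  also have "\<dots> = (\<Sum>j\<in>J. (c j)\<^sup>2 * (\<integral>w. centred j w * centred j w \<partial>X))"
  proof (rule sum.cong[OF refl])
    fix j assume j: "j \<in> J"
    have "(\<Sum>k\<in>J. (c j * c k) * (\<integral>w. centred j w * centred k w \<partial>X))
       = (\<Sum>k\<in>J. if k = j then (c j * c k) * (\<integral>w. centred j w * centred k w \<partial>X) else 0)"
      by (rule sum.cong) (auto simp: centred_orthogonal)
    also have "\<dots> = (c j)\<^sup>2 * (\<integral>w. centred j w * centred j w \<partial>X)"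
      using j J by (simp add: power2_eq_square)
    finally show "(\<Sum>k\<in>J. (c j * c k) * (\<integral>w. centred j w * centred k w \<partial>X)) = (c j)\<^sup>2 * (\<integral>w. centred j w * centred j w \<partial>X)" .
  qed
  also have "\<dots> \<le> (\<Sum>j\<in>J. (c j)\<^sup>2)"
  proof (rule sum_mono)
    fix j
    have "centred j w * centred j w \<le> 1" for w
      using mult_mono[OF centred_bound[of j w] centred_bound[of j w]] by simp
    then have "(\<integral>w. centred j w * centred j w \<partial>X) \<le> 1"
      by (intro X.integral_le_const icc) auto
    then show "(c j)\<^sup>2 * (\<integral>w. centred j w * centred j w \<partial>X) \<le> (c j)\<^sup>2"
      by (simp add: mult_left_le)
  qed
  finally have 2: "(\<integral>w. (s w)\<^sup>2 \<partial>X) \<le> (\<Sum>j\<in>J. (c j)\<^sup>2)" .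
  have "0 \<le> (\<integral>w. (b w - s w)\<^sup>2 \<partial>X)" by simp
  also have "(\<lambda>w. (b w - s w)\<^sup>2) = (\<lambda>w. (b w)\<^sup>2 - 2 * (b w * s w) + (s w)\<^sup>2)"
    by (auto simp: power2_eq_square algebra_simps)
  also have "(\<integral>w. (b w)\<^sup>2 - 2 * (b w * s w) + (s w)\<^sup>2 \<partial>X) = (\<integral>w. (b w)\<^sup>2 \<partial>X) - 2 * (\<integral>w. b w * s w \<partial>X) + (\<integral>w. (s w)\<^sup>2 \<partial>X)"
    using ibb isb iss by simp
  also have "(\<integral>w. (b w)\<^sup>2 \<partial>X) \<le> M\<^sup>2" using bb by (intro X.integral_le_const ibb) auto
  finally show ?thesis using 1 2 by (simp add: c_def)
qed

text \<open>A Riemann-Lebesgue argument: Bessel's inequality settles bounded densities, and truncation changes an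
integrable density by little in \<open>L\<^sup>1\<close> while the centred coordinates are bounded by one.\<close>

lemma density_coefficients_vanish:
  fixes D :: "_ \<Rightarrow> real"
  assumes D: "integrable X D" "\<And>w. 0 \<le> D w"
  shows "(\<lambda>n. \<integral>w. D w * centred (int n) w \<partial>X) \<longlonglongrightarrow> 0"
proof (rule LIMSEQ_I)
  fix e :: real assume e: "0 < e"
  have [measurable]: "D \<in> borel_measurable X" using D by auto
  have "(\<lambda>m. \<integral>w. min (D w) (real m) \<partial>X) \<longlonglongrightarrow> (\<integral>w. D w \<partial>X)"
  proof (rule integral_dominated_convergence[where w=D])
    show "AE w in X. (\<lambda>m. min (D w) (real m)) \<longlonglongrightarrow> D w"
    proof (intro always_eventually allI)
      fix w
      obtain m where "D w \<le> real m" using real_arch_simple by blast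
      then have "eventually (\<lambda>n. min (D w) (real n) = D w) sequentially"
        by (intro eventually_sequentiallyI[of m]) (auto simp: min_def)
      then show "(\<lambda>m. min (D w) (real m)) \<longlonglongrightarrow> D w" by (rule tendsto_eventually)
    qed
  qed (use D in auto)
  then have "eventually (\<lambda>m. (\<integral>w. D w \<partial>X) - e / 2 < (\<integral>w. min (D w) (real m) \<partial>X)) sequentially"
    using e by (intro order_tendstoD(1)) auto
  then obtain m where m: "(\<integral>w. D w \<partial>X) - e / 2 < (\<integral>w. min (D w) (real m) \<partial>X)"
    by (auto simp: eventually_sequentially)
  define b where "b w = min (D w) (real m)" for w
  have [measurable]: "b \<in> borel_measurable X" unfolding b_def by measurable
  have b: "\<bar>b w\<bar> \<le> real m" "b w \<le> D w" for w using D(2)[of w] by (auto simp: b_def)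
  have bi: "integrable X b" using b by (intro X.integrable_const_bound[where B="real m"]) auto
  have "summable (\<lambda>n. (\<integral>w. b w * centred (int n) w \<partial>X)\<^sup>2)"
  proof (rule summableI_nonneg_bounded)
    fix N
    have "(\<Sum>n<N. (\<integral>w. b w * centred (int n) w \<partial>X)\<^sup>2) = (\<Sum>k\<in>int ` {..<N}. (\<integral>w. b w * centred k w \<partial>X)\<^sup>2)"
      by (subst sum.reindex) (auto simp: inj_on_def)
    also have "\<dots> \<le> (real m)\<^sup>2" using b by (intro centred_bessel) auto
    finally show "(\<Sum>n<N. (\<integral>w. b w * centred (int n) w \<partial>X)\<^sup>2) \<le> (real m)\<^sup>2" .
  qed simp
  then have "(\<lambda>n. (\<integral>w. b w * centred (int n) w \<partial>X)\<^sup>2) \<longlonglongrightarrow> 0" by (rule summable_LIMSEQ_zero)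
  then have "(\<lambda>n. sqrt ((\<integral>w. b w * centred (int n) w \<partial>X)\<^sup>2)) \<longlonglongrightarrow> sqrt 0" by (rule tendsto_real_sqrt)
  then have "eventually (\<lambda>n. \<bar>\<integral>w. b w * centred (int n) w \<partial>X\<bar> < e / 2) sequentially"
    using e by (intro order_tendstoD(2)) auto
  then obtain N where N: "\<And>n. N \<le> n \<Longrightarrow> \<bar>\<integral>w. b w * centred (int n) w \<partial>X\<bar> < e / 2"
    by (auto simp: eventually_sequentially)
  show "\<exists>N. \<forall>n\<ge>N. norm ((\<integral>w. D w * centred (int n) w \<partial>X) - 0) < e"
  proof (intro exI allI impI)
    fix n assume n: "N \<le> n"
    let ?c = "centred (int n)"
    have ic: "integrable X (\<lambda>w. f w * ?c w)" if "integrable X f" for f :: "_ \<Rightarrow> real"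
      using that borel_measurable_integrable[OF that]
      by (intro Bochner_Integration.integrable_bound[OF that]) (auto simp: abs_mult mult_left_le centred_bound)
    have i1: "integrable X (\<lambda>w. b w * ?c w)" and i2: "integrable X (\<lambda>w. (D w - b w) * ?c w)"
      using D(1) bi by (auto intro!: ic)
    have "(\<integral>w. D w * ?c w \<partial>X) = (\<integral>w. b w * ?c w + (D w - b w) * ?c w \<partial>X)" by (simp add: algebra_simps)
    also have "\<dots> = (\<integral>w. b w * ?c w \<partial>X) + (\<integral>w. (D w - b w) * ?c w \<partial>X)" using i1 i2 by simp
    finally have "(\<integral>w. D w * ?c w \<partial>X) = \<dots>" .
    moreover have "\<bar>\<integral>w. (D w - b w) * ?c w \<partial>X\<bar> \<le> (\<integral>w. D w - b w \<partial>X)"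
    proof -
      have "\<bar>\<integral>w. (D w - b w) * ?c w \<partial>X\<bar> \<le> (\<integral>w. \<bar>(D w - b w) * ?c w\<bar> \<partial>X)" by (rule integral_abs_bound)
      also have "\<dots> \<le> (\<integral>w. D w - b w \<partial>X)"
        using i2 D(1) bi b(2) by (intro integral_mono integrable_abs) (auto simp: abs_mult mult_left_le centred_bound)
      finally show ?thesis .
    qed
    moreover have "(\<integral>w. D w - b w \<partial>X) < e / 2" using m D(1) bi by (simp add: b_def)
    ultimately show "norm ((\<integral>w. D w * ?c w \<partial>X) - 0) < e" using N[OF n] by simp
  qed
qed

end

section \<open>Dissipative weights\<close>

text \<open>The two-sided product of the factors \<open>Y (w j)\<close>, normalised to \<open>1\<close> at \<open>k = 0\<close>: for \<open>k \<ge> 0\<close> only the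
first product is nonempty, for \<open>k \<le> 0\<close> only the second.\<close>

definition potential :: "(bool \<Rightarrow> real) \<Rightarrow> (int \<Rightarrow> bool) \<Rightarrow> int \<Rightarrow> real" where
  "potential Y w k = (\<Prod>j\<in>{1..k}. Y (w j)) * (\<Prod>j\<in>{k + 1..0}. 1 / Y (w j))"

lemma potential_0: "potential Y w 0 = 1"
  by (simp add: potential_def)

lemma potential_step:
  assumes "\<And>b. 0 < Y b"
  shows "potential Y w (k + 1) = potential Y w k * Y (w (k + 1))"
proof (cases "0 \<le> k")
  case True
  then have "{1..k + 1} = insert (k + 1) {1..k}" by auto
  then show ?thesis using True by (simp add: potential_def)
next
  case False
  then have "{k + 1..0} = insert (k + 1) {k + 1 + 1..0}" by auto
  then have "(\<Prod>j\<in>{k + 1..0}. 1 / Y (w j)) = 1 / Y (w (k + 1)) * (\<Prod>j\<in>{k + 1 + 1..0}. 1 / Y (w j))"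
    by (simp only:) (subst prod.insert; simp)
  then show ?thesis using False assms[of "w (k + 1)"] by (simp add: potential_def)
qed

lemma potential_pos: "(\<And>b. 0 < Y b) \<Longrightarrow> 0 < potential Y w k"
  unfolding potential_def by (intro mult_pos_pos prod_pos) auto

lemma potential_shift:
  assumes Y: "\<And>b. 0 < Y b"
  shows "potential Y (full_shift w) k * potential Y w 1 = potential Y w (k + 1)"
proof (induction k rule: int_induct[where k=0])
  case base
  then show ?case by (simp add: potential_0)
next
  case (step1 i)
  have "potential Y (full_shift w) (i + 1) = potential Y (full_shift w) i * Y (w (i + 1 + 1))"
    using potential_step[where Y=Y and w="full_shift w" and k=i, OF Y] by (simp add: full_shift_def)
  then show ?case using step1.IH potential_step[where Y=Y and w=w and k="i + 1", OF Y] by (simp add: mult_ac)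
next
  case (step2 i)
  have "potential Y (full_shift w) i = potential Y (full_shift w) (i - 1) * Y (w (i + 1))"
    using potential_step[where Y=Y and w="full_shift w" and k="i - 1", OF Y] by (simp add: full_shift_def)
  then have "potential Y (full_shift w) (i - 1) * Y (w (i + 1)) * potential Y w 1 = potential Y w i * Y (w (i + 1))"
    using step2.IH potential_step[where Y=Y and w=w and k=i, OF Y] by simp
  then show ?case using Y[of "w (i + 1)"] by simp
qed

context bernoulli_factors
begin

lemma nn_integral_coord_prod:
  fixes f :: "bool \<Rightarrow> real"
  assumes f: "\<And>b. 0 \<le> f b" and "finite J"
  shows "(\<integral>\<^sup>+w. ennreal (\<Prod>j\<in>J. f (w j)) \<partial>X) = ennreal (\<Prod>j\<in>J. wt j True * f True + wt j False * f False)"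
  using \<open>finite J\<close>
proof (induction J rule: finite_induct)
  case empty
  then show ?case using X.emeasure_space_1 by simp
next
  case (insert k J)
  have [measurable]: "(\<lambda>w. f (w j)) \<in> borel_measurable X" for j
    by (rule measurable_compose[OF coord_measurable]) simp
  have upd: "(\<Prod>j\<in>insert k J. f ((w(k := b)) j)) = f b * (\<Prod>j\<in>J. f (w j))" for w b
  proof -
    have "(\<Prod>j\<in>J. f ((w(k := b)) j)) = (\<Prod>j\<in>J. f (w j))"
      using insert.hyps by (intro prod.cong) auto
    then show ?thesis using insert.hyps by simp
  qed
  have nn: "0 \<le> (\<Prod>j\<in>J. f (w j))" for w using f by (intro prod_nonneg) auto
  let ?m = "\<Prod>j\<in>J. wt j True * f True + wt j False * f False"
  have m: "0 \<le> ?m" using f by (intro prod_nonneg add_nonneg_nonneg mult_nonneg_nonneg) auto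
  have int: "(\<integral>\<^sup>+w. ennreal (f b * (\<Prod>j\<in>J. f (w j))) \<partial>X) = ennreal (f b) * ennreal ?m" for b
    using f nn insert.IH by (simp add: ennreal_mult nn_integral_cmult)
  have "(\<integral>\<^sup>+w. ennreal (\<Prod>j\<in>insert k J. f (w j)) \<partial>X)
    = ennreal (wt k True) * (ennreal (f True) * ennreal ?m) + ennreal (wt k False) * (ennreal (f False) * ennreal ?m)"
    by (subst nn_resample[of _ k]) (measurable, simp only: upd int)
  also have "\<dots> = ennreal ((wt k True * f True + wt k False * f False) * ?m)"
    using f m by (simp add: ennreal_mult[symmetric] ennreal_plus[symmetric] distrib_right mult.assoc del: ennreal_plus)
  finally show ?case using insert.hyps by simp
qed

lemma AE_summable_prod:
  fixes f :: "bool \<Rightarrow> real"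
  assumes f: "\<And>b. 0 \<le> f b" and J: "\<And>n. finite (J n)"
    and sm: "summable (\<lambda>n. \<Prod>j\<in>J n. wt j True * f True + wt j False * f False)"
  shows "AE w in X. (\<lambda>n :: nat. \<Prod>j\<in>J n. f (w j)) \<longlonglongrightarrow> 0"
proof -
  have [measurable]: "(\<lambda>w. f (w j)) \<in> borel_measurable X" for j
    by (rule measurable_compose[OF coord_measurable]) simp
  have m: "0 \<le> (\<Prod>j\<in>J n. wt j True * f True + wt j False * f False)" for n
    using f by (intro prod_nonneg add_nonneg_nonneg mult_nonneg_nonneg) auto
  have "(\<integral>\<^sup>+w. (\<Sum>n. ennreal (\<Prod>j\<in>J n. f (w j))) \<partial>X)
      = (\<Sum>n. ennreal (\<Prod>j\<in>J n. wt j True * f True + wt j False * f False))"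
    using f J by (subst nn_integral_suminf) (auto simp: nn_integral_coord_prod)
  also have "\<dots> = ennreal (\<Sum>n. \<Prod>j\<in>J n. wt j True * f True + wt j False * f False)"
    by (rule suminf_ennreal2[OF m sm])
  finally have "(\<integral>\<^sup>+w. (\<Sum>n. ennreal (\<Prod>j\<in>J n. f (w j))) \<partial>X) \<noteq> \<infinity>" by simp
  then have "AE w in X. (\<Sum>n. ennreal (\<Prod>j\<in>J n. f (w j))) \<noteq> \<infinity>"
    by (intro nn_integral_PInf_AE) auto
  then show ?thesis
  proof eventually_elim
    case (elim w)
    have "summable (\<lambda>n. \<Prod>j\<in>J n. f (w j))"
      using elim f by (intro summable_suminf_not_top) (auto intro: prod_nonneg)
    then show ?case by (rule summable_LIMSEQ_zero)
  qed
qed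

text \<open>A positive potential that tends to \<open>0\<close> in both directions has a last place of maximum. The shift moves
this place by one, so the events that the place is \<open>m\<close> are pairwise disjoint translates of each other;
they are wandering and cover almost everything.\<close>

lemma last_maximum_wandering:
  fixes Y :: "bool \<Rightarrow> real"
  assumes Y: "\<And>b. 0 < Y b"
    and pos: "AE w in X. (\<lambda>n. potential Y w (int n)) \<longlonglongrightarrow> 0"
    and neg: "AE w in X. (\<lambda>n. potential Y w (- int n)) \<longlonglongrightarrow> 0"
  shows "\<not> conservative X full_shift"
proof
  assume cons: "conservative X full_shift"
  define V where "V = potential Y"
  define Mx where "Mx m = {w. (\<forall>k>m. V w k < V w m) \<and> (\<forall>k<m. V w k \<le> V w m)}" for m
  have [measurable]: "(\<lambda>w. Y (w j)) \<in> borel_measurable X" for j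
    by (rule measurable_compose[OF coord_measurable]) simp
  have [measurable]: "(\<lambda>w. V w k) \<in> borel_measurable X" for k
    unfolding V_def potential_def by measurable
  have "{w \<in> space X. \<forall>k. (k \<le> m \<or> V w k < V w m) \<and> (m \<le> k \<or> V w k \<le> V w m)} \<in> sets X" for m
    by (intro sets.sets_Collect_countable_All sets.sets_Collect_conj sets.sets_Collect_disj
        sets.sets_Collect_const borel_measurable_le borel_measurable_less) measurable
  moreover have "{w \<in> space X. \<forall>k. (k \<le> m \<or> V w k < V w m) \<and> (m \<le> k \<or> V w k \<le> V w m)} = Mx m" for m
    by (auto simp: Mx_def) (metis not_le)+
  ultimately have MxX: "Mx m \<in> sets X" for m by simp
  have sh: "full_shift -` Mx m = Mx (m + 1)" for m
  proof (rule set_eqI)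
    fix w
    have V1: "0 < V w 1" unfolding V_def by (rule potential_pos[OF Y])
    have eq: "V w (k + 1) = V (full_shift w) k * V w 1" for k
      using potential_shift[where Y=Y and w=w and k=k, OF Y] by (simp add: V_def)
    have lt: "V (full_shift w) k < V (full_shift w) l \<longleftrightarrow> V w (k + 1) < V w (l + 1)"
      and le: "V (full_shift w) k \<le> V (full_shift w) l \<longleftrightarrow> V w (k + 1) \<le> V w (l + 1)" for k l
      unfolding eq using V1 by simp_all
    have "(\<forall>k>m. V w (k + 1) < V w (m + 1)) \<longleftrightarrow> (\<forall>k>m + 1. V w k < V w (m + 1))"
      by (metis (no_types, opaque_lifting) diff_add_cancel add_less_cancel_right)
    moreover have "(\<forall>k<m. V w (k + 1) \<le> V w (m + 1)) \<longleftrightarrow> (\<forall>k<m + 1. V w k \<le> V w (m + 1))"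
      by (metis (no_types, opaque_lifting) diff_add_cancel add_less_cancel_right)
    ultimately show "w \<in> full_shift -` Mx m \<longleftrightarrow> w \<in> Mx (m + 1)"
      by (simp add: Mx_def lt le)
  qed
  have shn: "(full_shift ^^ n) -` Mx m = Mx (m + int n)" for n m
  proof (induction n arbitrary: m)
    case (Suc n)
    have "(full_shift ^^ Suc n) -` Mx m = (full_shift ^^ n) -` (full_shift -` Mx m)"
      by (simp only: funpow.simps vimage_comp)
    also have "\<dots> = Mx (m + int (Suc n))" unfolding sh Suc.IH by (simp add: add_ac)
    finally show ?case .
  qed simp
  have disj: "Mx m \<inter> Mx n = {}" if "m \<noteq> n" for m n
  proof -
    have "Mx m \<inter> Mx n = {}" if "m < n" for m n
      using that by (force simp: Mx_def)
    then show ?thesis using that by (metis inf_commute linorder_neqE)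
  qed
  have "wandering X full_shift (Mx m)" for m
    unfolding wandering_def using MxX by (auto simp: shn disj)
  then have "Mx m \<in> null_sets X" for m using cons unfolding conservative_def by blast
  then have "AE w in X. \<forall>m. w \<notin> Mx m" unfolding AE_all_countable by (auto intro: AE_not_in)
  with pos neg have "AE w in X. False"
  proof eventually_elim
    case (elim w)
    have "eventually (\<lambda>n. V w (int n) < 1) sequentially" "eventually (\<lambda>n. V w (- int n) < 1) sequentially"
      using elim by (auto simp: V_def intro: order_tendstoD(2))
    then have "eventually (\<lambda>n. V w (int n) < 1 \<and> V w (- int n) < 1) sequentially"
      by (rule eventually_conj)
    then obtain N where N: "\<And>n. N \<le> n \<Longrightarrow> V w (int n) < 1 \<and> V w (- int n) < 1"
      by (auto simp: eventually_sequentially)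
    \<comment> \<open>The potential is \<open>1\<close> at \<open>0\<close>, so its maximum is attained on this finite set.\<close>
    define S where "S = {k. 1 \<le> V w k}"
    have "S \<subseteq> {- int N..int N}"
    proof
      fix k assume k: "k \<in> S"
      have "\<not> N \<le> nat \<bar>k\<bar>"
      proof
        assume "N \<le> nat \<bar>k\<bar>"
        then have "V w k < 1" using N[of "nat \<bar>k\<bar>"] by (cases "0 \<le> k") auto
        then show False using k by (simp add: S_def)
      qed
      then show "k \<in> {- int N..int N}" by auto
    qed
    then have finS: "finite S" by (rule finite_subset) simp
    have S0: "0 \<in> S" by (simp add: S_def V_def potential_0)
    define t where "t = Max (V w ` S)"
    have t: "V w k \<le> t" if "k \<in> S" for k unfolding t_def using finS that by simp
    have "t \<in> V w ` S" unfolding t_def using finS S0 by (intro Max_in) auto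
    then have t1: "1 \<le> t" by (auto simp: S_def)
    define R where "R = {k\<in>S. V w k = t}"
    have finR: "finite R" and "R \<noteq> {}" using finS \<open>t \<in> V w ` S\<close> by (auto simp: R_def)
    define m where "m = Max R"
    have "m \<in> R" unfolding m_def using finR \<open>R \<noteq> {}\<close> by (rule Max_in)
    then have Vm: "V w m = t" by (simp add: R_def)
    have le: "V w k \<le> t" for k using t[of k] t1 by (cases "k \<in> S") (auto simp: S_def)
    moreover have "V w k < t" if "m < k" for k
    proof -
      have "k \<notin> R" using that Max_ge[OF finR, of k] by (auto simp: m_def)
      then have "V w k \<noteq> t" using t1 by (auto simp: R_def S_def)
      then show ?thesis using le[of k] by simp
    qed
    ultimately have "w \<in> Mx m" by (simp add: Mx_def Vm)
    then show ?case using elim by blast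
  qed
  then show False by simp
qed

end

context half_stationary_factors
begin

text \<open>Choose \<open>Y\<close> as the square root of the density of the law with weight \<open>p = wt 0 a\<close> with respect to the law
with weight \<open>r\<close>. The mean of \<open>Y\<close> under the latter and the mean of \<open>1 / Y\<close> under the former both equal the
Hellinger affinity \<open>\<rho> < 1\<close> of the two laws. As \<open>Y a < 1 < Y (\<not> a)\<close>, more mass on \<open>a\<close> only lowers the mean
of \<open>Y\<close>. Hence the mean of the potential decays geometrically in both directions.\<close>

lemma dissipative_if_bounded_away:
  assumes r: "wt 0 a < r" and K: "\<And>n. N \<le> n \<Longrightarrow> r \<le> wt (int n) a"
  shows "\<not> conservative X full_shift"
proof -
  define p where "p = wt 0 a"
  have r1: "r < 1" using K[of N] wt_less_1[of "int N" a] by simp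
  have p: "0 < p" "p < r" using r wt_pos by (auto simp: p_def)
  define s t s' t' where "s = sqrt p" and "t = sqrt r" and "s' = sqrt (1 - p)" and "t' = sqrt (1 - r)"
  have pos: "0 < s" "s < t" "0 < t'" "t' < s'" "0 < t" "0 < s'"
    using p r1 by (auto simp: s_def t_def s'_def t'_def)
  have sq: "s * s = p" "t * t = r" "s' * s' = 1 - p" "t' * t' = 1 - r"
    using p r1 by (auto simp: s_def t_def s'_def t'_def)
  \<comment> \<open>The two values of \<open>Y\<close>, and the Hellinger affinity.\<close>
  define \<alpha> \<beta> \<rho> where "\<alpha> = s / t" and "\<beta> = s' / t'" and "\<rho> = s * t + s' * t'"
  have \<alpha>\<beta>: "0 < \<alpha>" "\<alpha> < 1" "1 < \<beta>" using pos by (auto simp: \<alpha>_def \<beta>_def)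
  have "0 < (s - t) * (s - t)" using pos by (intro mult_neg_neg) auto
  moreover have "0 \<le> (s' - t') * (s' - t')" by simp
  ultimately have \<rho>1: "\<rho> < 1" using sq by (simp add: \<rho>_def algebra_simps)
  have \<rho>0: "0 < \<rho>" using pos by (simp add: \<rho>_def add_pos_pos)
  have "r * \<alpha> = s * t" using pos by (simp add: \<alpha>_def sq(2)[symmetric])
  moreover have "(1 - r) * \<beta> = s' * t'" using pos by (simp add: \<beta>_def sq(4)[symmetric])
  ultimately have r\<alpha>: "r * \<alpha> + (1 - r) * \<beta> = \<rho>" by (simp add: \<rho>_def)
  have "p / \<alpha> = s * t" using pos by (simp add: \<alpha>_def sq(1)[symmetric])
  moreover have "(1 - p) / \<beta> = s' * t'" using pos by (simp add: \<beta>_def sq(3)[symmetric])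
  ultimately have p\<alpha>: "p / \<alpha> + (1 - p) / \<beta> = \<rho>" by (simp add: \<rho>_def)
  define Y where "Y b = (if b = a then \<alpha> else \<beta>)" for b
  have Y: "0 < Y b" for b using \<alpha>\<beta> by (auto simp: Y_def)
  have wtn: "wt k (\<not> a) = 1 - wt k a" for k using wt_sum[of k] by (cases a) auto
  have E: "wt k True * f True + wt k False * f False = wt k a * f a + (1 - wt k a) * f (\<not> a)" for k and f :: "bool \<Rightarrow> real"
    using wtn[of k] by (cases a) auto
  define m where "m k = wt k True * Y True + wt k False * Y False" for k
  define m' where "m' k = wt k True * (1 / Y True) + wt k False * (1 / Y False)" for k
  have m: "m k \<le> \<rho>" if "r \<le> wt k a" for k
  proof -
    have "m k = r * \<alpha> + (1 - r) * \<beta> + (wt k a - r) * (\<alpha> - \<beta>)"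
      unfolding m_def E[of k Y] by (simp add: Y_def algebra_simps)
    also have "(wt k a - r) * (\<alpha> - \<beta>) \<le> 0" using that \<alpha>\<beta> by (intro mult_nonneg_nonpos) auto
    finally show ?thesis using r\<alpha> by simp
  qed
  have m0: "0 \<le> m k" for k unfolding m_def using Y wt_pos by (intro add_nonneg_nonneg mult_nonneg_nonneg) (auto simp: less_imp_le)
  have m': "m' k = \<rho>" if "k \<le> 0" for k
    unfolding m'_def E[of k "\<lambda>b. 1 / Y b"] using p\<alpha> stationary[OF that, of a] by (simp add: Y_def p_def)
  have "AE w in X. (\<lambda>n. \<Prod>j\<in>{1..int n}. Y (w j)) \<longlonglongrightarrow> 0"
  proof (rule AE_summable_prod)
    show "summable (\<lambda>n. \<Prod>j\<in>{1..int n}. wt j True * Y True + wt j False * Y False)"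
    proof (rule summable_ratio_test[OF \<rho>1, of N])
      fix n assume n: "N \<le> n"
      have "{1..int (Suc n)} = insert (int (Suc n)) {1..int n}" by auto
      then have "(\<Prod>j\<in>{1..int (Suc n)}. m j) = m (int (Suc n)) * (\<Prod>j\<in>{1..int n}. m j)" by simp
      moreover have "m (int (Suc n)) \<le> \<rho>" using n by (intro m K) simp
      moreover have "0 \<le> (\<Prod>j\<in>{1..int n}. m j)" "0 \<le> m (int (Suc n))" using m0 by (auto intro: prod_nonneg)
      ultimately show "norm (\<Prod>j\<in>{1..int (Suc n)}. wt j True * Y True + wt j False * Y False)
          \<le> \<rho> * norm (\<Prod>j\<in>{1..int n}. wt j True * Y True + wt j False * Y False)"
        unfolding m_def[symmetric] by (simp add: mult_right_mono)
    qed
  qed (use Y in \<open>auto simp: less_imp_le\<close>)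
  moreover have "AE w in X. (\<lambda>n. \<Prod>j\<in>{- int n + 1..0}. 1 / Y (w j)) \<longlonglongrightarrow> 0"
  proof (rule AE_summable_prod)
    have pr: "(\<Prod>j\<in>{- int n + 1..0}. m' j) = \<rho> ^ n" for n
    proof -
      have "(\<Prod>j\<in>{- int n + 1..0}. m' j) = (\<Prod>j\<in>{- int n + 1..0}. \<rho>)" by (intro prod.cong m') auto
      then show ?thesis by simp
    qed
    show "summable (\<lambda>n. \<Prod>j\<in>{- int n + 1..0}. wt j True * (1 / Y True) + wt j False * (1 / Y False))"
      unfolding m'_def[symmetric] pr using \<rho>0 \<rho>1 by (intro summable_geometric) simp
  qed (use Y in \<open>auto simp: less_imp_le\<close>)
  ultimately show ?thesis
    by (intro last_maximum_wandering[OF Y]) (simp_all add: potential_def)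
qed

end

section \<open>Deviations of the weights from the stationary ones\<close>

lemma abs_ln_le: "1 / 2 \<le> y \<Longrightarrow> \<bar>ln y\<bar> \<le> 2 * \<bar>y - 1\<bar>" for y :: real
proof -
  assume y: "1 / 2 \<le> y"
  show ?thesis
  proof (cases "1 \<le> y")
    case True
    then show ?thesis using ln_le_minus_one[of y] by simp
  next
    case False
    have "- ln y = ln (1 / y)" using y by (simp add: ln_div)
    also have "\<dots> \<le> 1 / y - 1" using y by (intro ln_le_minus_one) simp
    also have "\<dots> = (1 - y) * (1 / y)" using y by (simp add: field_simps)
    also have "\<dots> \<le> (1 - y) * 2" using y False by (intro mult_left_mono) (auto simp: field_simps)
    finally show ?thesis using False y by simp
  qed
qed

lemma ln_ge: "0 < y \<Longrightarrow> 1 - 1 / y \<le> ln y" for y :: real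
  using ln_le_minus_one[of "1 / y"] by (simp add: ln_div)

context half_stationary_factors
begin

text \<open>The amount by which the flip of coordinate \<open>k\<close> moves the fibre coordinate.\<close>

definition log_odds :: "int \<Rightarrow> real" where
  "log_odds k = ln (wt k True * wt 0 False / (wt k False * wt 0 True))"

text \<open>Near the stationary weights, \<open>log_odds k\<close> and the deviation of the weights are comparable, and the
coordinate variance is bounded below.\<close>

lemma log_odds_bounds:
  defines "p \<equiv> wt 0 False"
  assumes d: "d = wt k False - p" and "\<bar>d\<bar> \<le> p / 2" "\<bar>d\<bar> \<le> (1 - p) / 2"
  shows "\<bar>log_odds k\<bar> \<le> 2 * \<bar>d\<bar> / (p * (1 - p))" "\<bar>d\<bar> \<le> \<bar>log_odds k\<bar>"
    "p * (1 - p) / 4 \<le> wt k True * wt k False"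
proof -
  define x where "x = wt k False"
  have x: "0 < x" "x < 1" and p: "0 < p" "p < 1"
    using wt_pos wt_less_1 by (auto simp: x_def p_def)
  have T: "wt k True = 1 - x" "wt 0 True = 1 - p" using wt_sum[of k] wt_sum[of 0] by (auto simp: x_def p_def)
  have xd: "x = p + d" using d by (simp add: x_def)
  have log_odds: "log_odds k = ln ((1 - x) / (1 - p)) - ln (x / p)"
    unfolding log_odds_def T using x p by (simp add: ln_div ln_mult x_def[symmetric] p_def[symmetric])
  have y1: "x / p - 1 = d / p" "(1 - x) / (1 - p) - 1 = - d / (1 - p)"
    using p by (auto simp: xd field_simps)
  have "1 / 2 \<le> x / p" "1 / 2 \<le> (1 - x) / (1 - p)"
    using assms(3,4) p by (auto simp: xd field_simps)
  then have "\<bar>ln (x / p)\<bar> \<le> 2 * \<bar>d / p\<bar>" "\<bar>ln ((1 - x) / (1 - p))\<bar> \<le> 2 * \<bar>- d / (1 - p)\<bar>"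
    using abs_ln_le[of "x / p"] abs_ln_le[of "(1 - x) / (1 - p)"] unfolding y1 by auto
  then have "\<bar>log_odds k\<bar> \<le> 2 * (\<bar>d\<bar> / p) + 2 * (\<bar>d\<bar> / (1 - p))"
    using p unfolding log_odds by (simp add: abs_divide)
  also have "\<dots> = 2 * \<bar>d\<bar> / (p * (1 - p))" using p by (simp add: field_simps)
  finally show "\<bar>log_odds k\<bar> \<le> 2 * \<bar>d\<bar> / (p * (1 - p))" .
  show "\<bar>d\<bar> \<le> \<bar>log_odds k\<bar>"
  proof (cases "0 \<le> d")
    case True
    have "d \<le> d / x" using True x by (simp add: field_simps mult_left_le)
    also have "d / x = 1 - 1 / (x / p)" using x p by (simp add: xd field_simps)
    also have "\<dots> \<le> ln (x / p)" using x p by (intro ln_ge) simp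
    finally have "d \<le> ln (x / p)" .
    moreover have "ln ((1 - x) / (1 - p)) \<le> 0" using True x p by (subst ln_le_zero_iff) (auto simp: xd)
    ultimately show ?thesis using True unfolding log_odds by linarith
  next
    case False
    have "- d \<le> - d / (1 - x)" using False x by (simp add: field_simps mult_le_0_iff)
    also have "- d / (1 - x) = 1 - 1 / ((1 - x) / (1 - p))" using x p by (simp add: xd field_simps)
    also have "\<dots> \<le> ln ((1 - x) / (1 - p))" using x p by (intro ln_ge) simp
    finally have "- d \<le> ln ((1 - x) / (1 - p))" .
    moreover have "ln (x / p) \<le> 0" using False x p by (subst ln_le_zero_iff) (auto simp: xd)
    ultimately show ?thesis using False unfolding log_odds by linarith
  qed
  have "(1 - p) / 2 * (p / 2) \<le> (1 - x) * x"
    using assms(3,4) p by (intro mult_mono) (auto simp: xd)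
  then show "p * (1 - p) / 4 \<le> wt k True * wt k False" by (simp add: T x_def[symmetric] mult_ac)
qed

text \<open>Three cases. If the deviations are eventually below \<open>\<kappa> / 2\<close>, their squares still have an infinite sum.
If they are eventually at least \<open>\<kappa> / 2\<close> in absolute value, the small jumps keep their sign constant and
the shift is dissipative. Otherwise their absolute values climb from below \<open>\<kappa> / 2\<close> to at least \<open>\<kappa> / 2\<close>
infinitely often, and by the small jumps the first value reached lies below \<open>\<kappa>\<close>.\<close>

lemma many_small_deviations:
  assumes cons: "conservative X full_shift" and ns: "\<not> summable (\<lambda>n. (dev n)\<^sup>2)"
    and jumps: "(\<lambda>n. dev (Suc n) - dev n) \<longlonglongrightarrow> 0"
    and kap: "0 < \<kappa>" and J: "finite J"
  shows "\<exists>I. finite I \<and> I \<inter> J = {} \<and> (\<forall>n\<in>I. \<bar>dev n\<bar> < \<kappa>) \<and> b \<le> (\<Sum>n\<in>I. (dev n)\<^sup>2)"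
proof -
  obtain NJ where NJ: "\<And>n. n \<in> J \<Longrightarrow> n < NJ"
    using J by (meson finite_nat_set_iff_bounded)
  have "eventually (\<lambda>n. \<bar>dev (Suc n) - dev n\<bar> < \<kappa> / 2) sequentially"
    using tendsto_rabs_zero[OF jumps] kap by (intro order_tendstoD(2)) auto
  then obtain Nj where Nj: "\<And>n. Nj \<le> n \<Longrightarrow> \<bar>dev (Suc n) - dev n\<bar> < \<kappa> / 2"
    by (auto simp: eventually_sequentially)
  consider (small) N where "\<And>n. N \<le> n \<Longrightarrow> \<bar>dev n\<bar> < \<kappa> / 2"
    | (large) N where "\<And>n. N \<le> n \<Longrightarrow> \<kappa> / 2 \<le> \<bar>dev n\<bar>"
    | (mixed) "\<And>N. \<exists>n\<ge>N. \<bar>dev n\<bar> < \<kappa> / 2" "\<And>N. \<exists>n\<ge>N. \<kappa> / 2 \<le> \<bar>dev n\<bar>"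
    by (meson not_le)
  then show ?thesis
  proof cases
    case small
    define M where "M = max N NJ"
    have "\<not> summable (\<lambda>n. (dev (n + M))\<^sup>2)" using ns summable_iff_shift[of "\<lambda>n. (dev n)\<^sup>2" M] by simp
    then obtain m where m: "b < (\<Sum>n<m. (dev (n + M))\<^sup>2)"
      using summableI_nonneg_bounded[of "\<lambda>n. (dev (n + M))\<^sup>2" b] by (metis not_le zero_le_power2)
    have "(\<Sum>n<m. (dev (n + M))\<^sup>2) = (\<Sum>n\<in>(\<lambda>n. n + M) ` {..<m}. (dev n)\<^sup>2)"
      by (subst sum.reindex) (auto simp: inj_on_def)
    moreover have "\<bar>dev n\<bar> < \<kappa>" if "M \<le> n" for n using small[of n] that kap by (simp add: M_def)
    moreover have "n \<notin> J" if "M \<le> n" for n using NJ[of n] that by (auto simp: M_def)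
    ultimately show ?thesis using m by (intro exI[of _ "(\<lambda>n. n + M) ` {..<m}"]) auto
  next
    case large
    define M where "M = max N Nj"
    have "(\<forall>n\<ge>M. \<kappa> / 2 \<le> dev n) \<or> (\<forall>n\<ge>M. dev n \<le> - (\<kappa> / 2))"
    proof (cases "0 \<le> dev M")
      case True
      have "\<kappa> / 2 \<le> dev n" if "M \<le> n" for n
        using that
      proof (induction n rule: dec_induct)
        case base
        then show ?case using large[of M] True by (simp add: M_def)
      next
        case (step n)
        then have "N \<le> Suc n" "Nj \<le> n" by (auto simp: M_def)
        then show ?case using large[of "Suc n"] Nj[of n] step.IH kap by linarith
      qed
      then show ?thesis by blast
    next
      case False
      have "dev n \<le> - (\<kappa> / 2)" if "M \<le> n" for n
        using that
      proof (induction n rule: dec_induct)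
        case base
        then show ?case using large[of M] False by (simp add: M_def)
      next
        case (step n)
        then have "N \<le> Suc n" "Nj \<le> n" by (auto simp: M_def)
        then show ?case using large[of "Suc n"] Nj[of n] step.IH kap by linarith
      qed
      then show ?thesis by blast
    qed
    then have "\<not> conservative X full_shift"
    proof
      assume "\<forall>n\<ge>M. \<kappa> / 2 \<le> dev n"
      then show ?thesis using kap
        by (intro dissipative_if_bounded_away[of False "wt 0 False + \<kappa> / 2" M]) (auto simp: dev_def algebra_simps)
    next
      assume *: "\<forall>n\<ge>M. dev n \<le> - (\<kappa> / 2)"
      have "wt 0 True + \<kappa> / 2 \<le> wt (int n) True" if "M \<le> n" for n
        using *[rule_format, OF that] wt_sum[of 0] wt_sum[of "int n"] by (simp add: dev_def)
      then show ?thesis using kap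
        by (intro dissipative_if_bounded_away[of True "wt 0 True + \<kappa> / 2" M]) auto
    qed
    then show ?thesis using cons by blast
  next
    case mixed
    define S where "S = {n. NJ \<le> n \<and> \<kappa> / 2 \<le> \<bar>dev n\<bar> \<and> \<bar>dev n\<bar> < \<kappa>}"
    have "\<exists>n\<ge>N. n \<in> S" for N
    proof -
      obtain n1 where n1: "max N (max NJ Nj) \<le> n1" "\<bar>dev n1\<bar> < \<kappa> / 2" using mixed(1) by blast
      obtain n2 where n2: "n1 \<le> n2" "\<kappa> / 2 \<le> \<bar>dev n2\<bar>" using mixed(2) by blast
      define n where "n = (LEAST n. n1 \<le> n \<and> \<kappa> / 2 \<le> \<bar>dev n\<bar>)"
      have n: "n1 \<le> n" "\<kappa> / 2 \<le> \<bar>dev n\<bar>"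
        using LeastI[of "\<lambda>n. n1 \<le> n \<and> \<kappa> / 2 \<le> \<bar>dev n\<bar>" n2] n2 by (auto simp: n_def)
      then have "n \<noteq> n1" using n1 by auto
      then obtain n' where n': "n = Suc n'" "n1 \<le> n'" using n(1) by (cases n) auto
      have "n' < n" using n' by simp
      then have "\<not> (n1 \<le> n' \<and> \<kappa> / 2 \<le> \<bar>dev n'\<bar>)" unfolding n_def by (rule not_less_Least)
      then have "\<bar>dev n'\<bar> < \<kappa> / 2" using n' by simp
      moreover have "\<bar>dev (Suc n') - dev n'\<bar> < \<kappa> / 2" using Nj[of n'] n' n1 by simp
      ultimately have "\<bar>dev n\<bar> < \<kappa>" unfolding n'(1) by linarith
      then show ?thesis using n n1 by (intro exI[of _ n]) (auto simp: S_def)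
    qed
    then have "infinite S" by (metis finite_nat_set_iff_bounded not_le)
    obtain m :: nat where m: "b / (\<kappa> / 2)\<^sup>2 \<le> real m" using real_arch_simple by blast
    obtain I where I: "finite I" "card I = m" "I \<subseteq> S"
      using infinite_arbitrarily_large[OF \<open>infinite S\<close>, of m] by blast
    have "b \<le> real m * (\<kappa> / 2)\<^sup>2" using m kap by (simp add: pos_divide_le_eq)
    also have "\<dots> = (\<Sum>n\<in>I. (\<kappa> / 2)\<^sup>2)" using I by simp
    also have "\<dots> \<le> (\<Sum>n\<in>I. (dev n)\<^sup>2)"
    proof (rule sum_mono)
      fix n assume "n \<in> I"
      then have "\<kappa> / 2 \<le> \<bar>dev n\<bar>" using I by (auto simp: S_def)
      then show "(\<kappa> / 2)\<^sup>2 \<le> (dev n)\<^sup>2" using kap by (simp add: abs_le_square_iff[symmetric])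
    qed
    moreover have "n \<notin> J" if "n \<in> S" for n using NJ[of n] that by (auto simp: S_def)
    moreover have "\<bar>dev n\<bar> < \<kappa>" if "n \<in> S" for n using that by (simp add: S_def)
    ultimately show ?thesis using I by (intro exI[of _ I]) auto
  qed
qed

lemma abundant_log_odds:
  assumes cons: "conservative X full_shift" and ns: "\<not> summable (\<lambda>n. (dev n)\<^sup>2)"
    and jumps: "(\<lambda>n. dev (Suc n) - dev n) \<longlonglongrightarrow> 0"
  shows "abundant log_odds"
  unfolding abundant_def
proof (intro allI impI)
  fix e b :: real and J :: "int set" assume e: "0 < e" and J: "finite J"
  define p where "p = wt 0 False"
  have p: "0 < p" "p < 1" using wt_pos wt_less_1 by (auto simp: p_def)
  define \<kappa> where "\<kappa> = min (min (p / 2) ((1 - p) / 2)) (e * (p * (1 - p)) / 2)"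
  have k0: "0 < \<kappa>" using p e by (auto simp: \<kappa>_def)
  have k: "\<kappa> \<le> p / 2" "\<kappa> \<le> (1 - p) / 2" "\<kappa> \<le> e * (p * (1 - p)) / 2"
    unfolding \<kappa>_def by linarith+
  define c where "c = p * (1 - p) / 4"
  have c: "0 < c" using p by (simp add: c_def)
  have "finite (int -` J)" using J by (intro finite_vimageI) (auto simp: inj_def)
  then obtain I where I: "finite I" "I \<inter> int -` J = {}" "\<And>n. n \<in> I \<Longrightarrow> \<bar>dev n\<bar> < \<kappa>" "b / c \<le> (\<Sum>n\<in>I. (dev n)\<^sup>2)"
    using many_small_deviations[OF cons ns jumps k0, of "int -` J" "b / c"] by metis
  have bd: "\<bar>log_odds (int n)\<bar> \<le> e" "\<bar>dev n\<bar> \<le> \<bar>log_odds (int n)\<bar>" "c \<le> wt (int n) True * wt (int n) False" if n: "n \<in> I" for n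
  proof -
    have 1: "dev n = wt (int n) False - wt 0 False" by (simp add: dev_def)
    have 2: "\<bar>dev n\<bar> \<le> wt 0 False / 2" "\<bar>dev n\<bar> \<le> (1 - wt 0 False) / 2"
      using I(3)[OF n] k by (auto simp: p_def)
    note b = log_odds_bounds[OF 1 2, folded p_def]
    have "2 * \<bar>dev n\<bar> / (p * (1 - p)) \<le> e" using I(3)[OF n] k p by (simp add: pos_divide_le_eq)
    then show "\<bar>log_odds (int n)\<bar> \<le> e" using b(1) by linarith
    show "\<bar>dev n\<bar> \<le> \<bar>log_odds (int n)\<bar>" "c \<le> wt (int n) True * wt (int n) False" using b by (auto simp: c_def)
  qed
  have "b \<le> c * (\<Sum>n\<in>I. (dev n)\<^sup>2)" using I(4) c by (simp add: pos_divide_le_eq mult.commute)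
  also have "\<dots> = (\<Sum>n\<in>I. c * (dev n)\<^sup>2)" by (simp add: sum_distrib_left)
  also have "\<dots> \<le> (\<Sum>n\<in>I. wt (int n) True * wt (int n) False * (log_odds (int n))\<^sup>2)"
    using bd c by (intro sum_mono mult_mono) (auto simp: abs_le_square_iff[symmetric])
  also have "\<dots> = (\<Sum>k\<in>int ` I. wt k True * wt k False * (log_odds k)\<^sup>2)"
    by (subst sum.reindex) (auto simp: inj_on_def)
  finally show "\<exists>I. finite I \<and> I \<inter> J = {} \<and> (\<forall>k\<in>I. \<bar>log_odds k\<bar> \<le> e) \<and>
      b \<le> (\<Sum>k\<in>I. wt k True * wt k False * (log_odds k)\<^sup>2)"
    using I bd by (intro exI[of _ "int ` I"]) auto
qed

end

section \<open>The derivative of the shift\<close>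

definition unshift :: "(int \<Rightarrow> bool) \<Rightarrow> (int \<Rightarrow> bool)" where
  "unshift w = (\<lambda>k. w (k - 1))"

lemma full_shift_unshift [simp]: "full_shift (unshift w) = w" "unshift (full_shift w) = w"
  by (simp_all add: full_shift_def unshift_def)

lemma the_inv_full_shift: "the_inv_into UNIV full_shift = unshift"
  by (rule ext) (metis full_shift_unshift inj_on_inverseI the_inv_into_f_f UNIV_I)

lemma funpow_left_inverse:
  fixes f g :: "'a \<Rightarrow> 'a"
  assumes "\<And>z. f (g z) = z" shows "(f ^^ n) ((g ^^ n) z) = z"
proof (induction n arbitrary: z)
  case (Suc n)
  have "(f ^^ Suc n) ((g ^^ Suc n) z) = (f ^^ n) (f (g ((g ^^ n) z)))"
    by (simp only: funpow_Suc_right[of n f] funpow.simps(2)[of n g] o_apply)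
  then show ?case using assms Suc.IH by simp
qed simp

lemma AE_lborel_translate:
  fixes c :: real
  assumes "AE y in lborel. Q y" shows "AE y in lborel. Q (y + c)"
proof -
  have "AE y in distr lborel borel ((+) c). Q y" using assms by (subst lborel_distr_plus)
  then have "AE y in lborel. Q (c + y)" by (intro AE_distrD[of "(+) c" lborel borel]) simp_all
  then show ?thesis by (simp add: add.commute)
qed

context bernoulli_factors
begin

lemma full_shift_measurable [measurable]: "full_shift \<in> X \<rightarrow>\<^sub>M X"
  by (rule measurable_into_X) (simp add: full_shift_def)

lemma unshift_measurable [measurable]: "unshift \<in> X \<rightarrow>\<^sub>M X"
  by (rule measurable_into_X) (simp add: unshift_def)

lemma emeasure_coord: "emeasure X {w. w k = a} = ennreal (wt k a)"
proof -
  have "{w \<in> space X. w k = a} \<in> sets X" by measurable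
  then have [measurable]: "{w. w k = a} \<in> sets X" by simp
  have "emeasure X {w. w k = a} = (\<integral>\<^sup>+w. indicator {w. w k = a} w \<partial>X)" by simp
  also have "\<dots> = ennreal (wt k True) * (\<integral>\<^sup>+w. indicator {w. w k = a} (w(k := True)) \<partial>X)
     + ennreal (wt k False) * (\<integral>\<^sup>+w. indicator {w. w k = a} (w(k := False)) \<partial>X)"
    by (rule nn_resample) simp
  also have "\<dots> = ennreal (wt k a)"
    using X.emeasure_space_1 by (cases a) (simp_all add: indicator_def)
  finally show ?thesis .
qed

text \<open>The shift exchanges the events \<open>w k = a\<close> and \<open>w (k + 1) = a\<close>, so one is null only if the other is.\<close>

lemma nonsingular_wt_pos:
  assumes ns: "nonsingular X full_shift" and "0 < wt 0 a"
  shows "0 < wt k a"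
proof -
  have step: "0 < wt k a \<longleftrightarrow> 0 < wt (k + 1) a" for k
  proof -
    have "{w \<in> space X. w k = a} \<in> sets X" by measurable
    then have [measurable]: "{w. w k = a} \<in> sets X" by simp
    have "full_shift -` {w. w k = a} = {w. w (k + 1) = a}" by (auto simp: full_shift_def)
    then have "emeasure (distr X X full_shift) {w. w k = a} = ennreal (wt (k + 1) a)"
      by (subst emeasure_distr) (auto simp: emeasure_coord)
    moreover have "{w. w k = a} \<in> null_sets (distr X X full_shift) \<longleftrightarrow> {w. w k = a} \<in> null_sets X"
      using ns by (simp add: nonsingular_def)
    ultimately show ?thesis
      by (auto simp: null_sets_def emeasure_coord order_less_le)
  qed
  show ?thesis
  proof (induction k rule: int_induct[where k=0])
    case base show ?case by fact
  next
    case (step1 i) then show ?case using step by blast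
  next
    case (step2 i) then show ?case using step[of "i - 1"] by simp
  qed
qed

end

locale nonsingular_shift = half_stationary_factors +
  assumes nonsing: "nonsingular X full_shift"
begin

lemma AE_full_shift:
  assumes "AE w in X. Q w" shows "AE w in X. Q (full_shift w)"
proof -
  have "absolutely_continuous X (distr X X full_shift)"
    using nonsing by (simp add: absolutely_continuous_def nonsingular_def)
  from absolutely_continuous_AE[OF sets_distr this assms]
  have "AE w in distr X X full_shift. Q w" .
  then show ?thesis by (intro AE_distrD[of full_shift X X]) simp_all
qed

lemma null_unshift:
  assumes [measurable]: "N \<in> sets X"
  shows "unshift -` N \<in> null_sets X \<longleftrightarrow> N \<in> null_sets X"
proof -
  have "unshift -` N \<inter> space X \<in> sets X" by measurable
  then have [measurable]: "unshift -` N \<in> sets X" by simp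
  have "unshift -` N \<in> null_sets X \<longleftrightarrow> unshift -` N \<in> null_sets (distr X X full_shift)"
    using nonsing by (simp add: nonsingular_def)
  also have "\<dots> \<longleftrightarrow> full_shift -` (unshift -` N) \<in> null_sets X"
    by (subst null_sets_distr_iff) auto
  also have "full_shift -` (unshift -` N) = N" by auto
  finally show ?thesis .
qed

sublocale Q: bernoulli_factors "\<lambda>k. P (k - 1)"
  by (rule bernoulli_factors.intro) (rule prob_P sets_P)+

lemma sets_Q: "sets Q.X = sets X"
  by (rule sets_PiM_cong) (simp_all add: sets_P)

lemma Q_wt: "Q.wt k a = wt (k - 1) a"
  by (simp add: Q.wt_def wt_def)

lemma distr_unshift: "distr X X unshift = Q.X"
proof -
  have "distr X Q.X (\<lambda>w. \<lambda>n\<in>UNIV. w (n - 1)) = Q.X"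
    using prob_P by (intro distr_PiM_reindex) (auto simp: inj_on_def)
  moreover have "(\<lambda>w. \<lambda>n\<in>UNIV. w (n - 1)) = unshift" by (auto simp: unshift_def fun_eq_iff)
  moreover have "distr X X unshift = distr X Q.X unshift" by (rule distr_cong) (simp_all add: sets_Q)
  ultimately show ?thesis by simp
qed

definition D :: "(int \<Rightarrow> bool) \<Rightarrow> real" where
  "D = transformation_deriv X full_shift"

lemma D_eq: "D w = enn2real (RN_deriv X Q.X w)"
  by (simp add: D_def transformation_deriv_def the_inv_full_shift distr_unshift)

lemma D_nonneg: "0 \<le> D w"
  by (simp add: D_eq)

lemma D_measurable [measurable]: "D \<in> borel_measurable X"
  unfolding D_eq[abs_def] by measurable

lemma null_Q: "N \<in> null_sets Q.X \<longleftrightarrow> N \<in> null_sets X"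
proof (cases "N \<in> sets X")
  case True
  then have "N \<in> null_sets (distr X X unshift) \<longleftrightarrow> unshift -` N \<in> null_sets X"
    by (subst null_sets_distr_iff) auto
  then show ?thesis using null_unshift[OF True] by (simp add: distr_unshift)
next
  case False
  then show ?thesis using null_setsD2[of N X] null_setsD2[of N Q.X] unfolding sets_Q by blast
qed

lemma density_D: "density X (\<lambda>w. ennreal (D w)) = Q.X"
proof -
  have ac: "absolutely_continuous X Q.X" using null_Q by (auto simp: absolutely_continuous_def)
  have "AE w in X. RN_deriv X Q.X w \<noteq> \<infinity>"
    by (rule X.RN_deriv_finite[OF _ ac sets_Q]) unfold_locales
  then have "AE w in X. ennreal (D w) = RN_deriv X Q.X w"
    by eventually_elim (auto simp: D_eq less_top)
  then have "density X (\<lambda>w. ennreal (D w)) = density X (RN_deriv X Q.X)"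
    by (intro density_cong) auto
  then show ?thesis using X.density_RN_deriv[OF ac sets_Q] by simp
qed

lemma nn_integral_Q:
  assumes [measurable]: "f \<in> borel_measurable X"
  shows "(\<integral>\<^sup>+w. f w \<partial>Q.X) = (\<integral>\<^sup>+w. ennreal (D w) * f w \<partial>X)"
  by (subst density_D[symmetric], subst nn_integral_density) auto

lemma D_pos: "AE w in X. 0 < D w"
proof -
  have "{w \<in> space X. D w = 0} \<in> sets X" by measurable
  then have Z [measurable]: "{w. D w = 0} \<in> sets X" by simp
  have "emeasure Q.X {w. D w = 0} = (\<integral>\<^sup>+w. indicator {w. D w = 0} w \<partial>Q.X)"
    using Z by (simp add: sets_Q)
  also have "\<dots> = (\<integral>\<^sup>+w. ennreal (D w) * indicator {w. D w = 0} w \<partial>X)"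
    by (rule nn_integral_Q) simp
  also have "\<dots> = 0" by (subst nn_integral_0_iff_AE) (auto split: split_indicator)
  finally have "{w. D w = 0} \<in> null_sets Q.X" using Z by (auto simp: null_sets_def sets_Q)
  then have "{w. D w = 0} \<in> null_sets X" by (simp add: null_Q)
  then have "AE w in X. w \<notin> {w. D w = 0}" by (rule AE_not_in)
  then show ?thesis by eventually_elim (use D_nonneg in \<open>auto simp: order_less_le\<close>)
qed

text \<open>The density of the product of the \<open>P (k - 1)\<close> with respect to the product of the \<open>P k\<close> splits off
the factor of coordinate \<open>k\<close>. The remaining factor \<open>u\<close> is obtained by averaging the density over that
coordinate; that \<open>u\<close> times the quotient of weights is again a density follows by resampling, and
densities are unique.\<close>

lemma D_flip: "AE w in X. \<exists>u>0. \<forall>a. D (w(k := a)) = u * (wt (k - 1) a / wt k a)"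
proof -
  define u where "u w = wt k True * D (w(k := True)) + wt k False * D (w(k := False))" for w
  define q where "q a = wt (k - 1) a / wt k a" for a
  have q: "0 < q a" for a using wt_pos by (simp add: q_def)
  have u0: "0 \<le> u w" for w using D_nonneg by (simp add: u_def)
  have uk: "u (w(k := a)) = u w" for w a by (simp add: u_def)
  have [measurable]: "u \<in> borel_measurable X" unfolding u_def by measurable
  have [measurable]: "(\<lambda>w. q (w k)) \<in> borel_measurable X"
    by (rule measurable_compose[OF coord_measurable]) simp
  have uint: "(\<integral>\<^sup>+w. ennreal (u w) * G w \<partial>X) = (\<integral>\<^sup>+w. G w \<partial>Q.X)"
    if [measurable]: "G \<in> borel_measurable X" and Gk: "\<And>w a. G (w(k := a)) = G w" for G
  proof -
    have "(\<integral>\<^sup>+w. ennreal (u w) * G w \<partial>X)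
        = (\<integral>\<^sup>+w. ennreal (wt k True) * (ennreal (D (w(k := True))) * G w)
            + ennreal (wt k False) * (ennreal (D (w(k := False))) * G w) \<partial>X)"
      using D_nonneg by (intro nn_integral_cong)
        (simp add: u_def ennreal_mult ennreal_plus distrib_right mult.assoc)
    also have "\<dots> = ennreal (wt k True) * (\<integral>\<^sup>+w. ennreal (D (w(k := True))) * G w \<partial>X)
        + ennreal (wt k False) * (\<integral>\<^sup>+w. ennreal (D (w(k := False))) * G w \<partial>X)"
      by (subst nn_integral_add) (auto simp: nn_integral_cmult)
    also have "\<dots> = (\<integral>\<^sup>+w. ennreal (D w) * G w \<partial>X)"
      by (subst (3) nn_resample[of _ k]) (auto simp: Gk)
    also have "\<dots> = (\<integral>\<^sup>+w. G w \<partial>Q.X)" by (rule nn_integral_Q[symmetric]) simp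
    finally show ?thesis .
  qed
  have "density X (\<lambda>w. ennreal (u w * q (w k))) = Q.X"
  proof (rule measure_eqI)
    fix A assume "A \<in> sets (density X (\<lambda>w. ennreal (u w * q (w k))))"
    then have [measurable]: "A \<in> sets X" by simp
    have [measurable]: "A \<in> sets Q.X" using sets_Q by simp
    have "emeasure (density X (\<lambda>w. ennreal (u w * q (w k)))) A
        = (\<integral>\<^sup>+w. ennreal (u w * q (w k)) * indicator A w \<partial>X)"
      by (subst emeasure_density) auto
    also have "\<dots> = ennreal (wt k True) * (\<integral>\<^sup>+w. ennreal (u w * q True) * indicator A (w(k := True)) \<partial>X)
        + ennreal (wt k False) * (\<integral>\<^sup>+w. ennreal (u w * q False) * indicator A (w(k := False)) \<partial>X)"
      by (subst nn_resample[of _ k]) (auto simp: uk)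
    also have "\<dots> = ennreal (wt (k - 1) True) * (\<integral>\<^sup>+w. indicator A (w(k := True)) \<partial>Q.X)
        + ennreal (wt (k - 1) False) * (\<integral>\<^sup>+w. indicator A (w(k := False)) \<partial>Q.X)"
    proof -
      have "ennreal (wt k a) * (\<integral>\<^sup>+w. ennreal (u w * q a) * indicator A (w(k := a)) \<partial>X)
          = ennreal (wt (k - 1) a) * (\<integral>\<^sup>+w. indicator A (w(k := a)) \<partial>Q.X)" for a
      proof -
        have "(\<integral>\<^sup>+w. ennreal (u w * q a) * indicator A (w(k := a)) \<partial>X)
            = (\<integral>\<^sup>+w. ennreal (q a) * (ennreal (u w) * indicator A (w(k := a))) \<partial>X)"
          using u0 q[of a] by (intro nn_integral_cong) (simp add: ennreal_mult less_imp_le mult_ac)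
        also have "\<dots> = ennreal (q a) * (\<integral>\<^sup>+w. ennreal (u w) * indicator A (w(k := a)) \<partial>X)"
          by (rule nn_integral_cmult) simp
        also have "(\<integral>\<^sup>+w. ennreal (u w) * indicator A (w(k := a)) \<partial>X) = (\<integral>\<^sup>+w. indicator A (w(k := a)) \<partial>Q.X)"
          by (rule uint) auto
        finally have E: "(\<integral>\<^sup>+w. ennreal (u w * q a) * indicator A (w(k := a)) \<partial>X)
          = ennreal (q a) * (\<integral>\<^sup>+w. indicator A (w(k := a)) \<partial>Q.X)" .
        have "ennreal (wt k a) * (\<integral>\<^sup>+w. ennreal (u w * q a) * indicator A (w(k := a)) \<partial>X)
          = ennreal (wt k a * q a) * (\<integral>\<^sup>+w. indicator A (w(k := a)) \<partial>Q.X)"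
          unfolding E using q[of a] by (simp add: ennreal_mult mult.assoc less_imp_le)
        also have "wt k a * q a = wt (k - 1) a" using wt_pos[of k a] by (simp add: q_def)
        finally show ?thesis .
      qed
      then show ?thesis by simp
    qed
    also have "\<dots> = (\<integral>\<^sup>+w. indicator A w \<partial>Q.X)"
      by (subst (3) Q.nn_resample[of _ k]) (auto simp: Q_wt)
    finally show "emeasure (density X (\<lambda>w. ennreal (u w * q (w k)))) A = emeasure Q.X A" by simp
  qed (simp add: sets_Q)
  then have "AE w in X. ennreal (D w) = ennreal (u w * q (w k))"
    using density_D by (intro X.density_unique) auto
  then have *: "AE w in X. 0 < D w \<and> D w = u w * q (w k)"
    using D_pos by eventually_elim (use u0 q D_nonneg in \<open>auto simp: less_imp_le\<close>)
  from AE_upd[OF wt_pos[of k True] *] AE_upd[OF wt_pos[of k False] *]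
  show ?thesis
  proof eventually_elim
    case (elim w)
    have "D (w(k := a)) = u w * q a" for a using elim by (cases a) (auto simp: uk)
    moreover have "0 < u w" using elim q[of True] by (auto simp: uk zero_less_mult_iff)
    ultimately show ?case by (auto simp: q_def)
  qed
qed

lemma log_odds_cocycle:
  assumes "0 < u" and D: "\<And>a. D (w(k := a)) = u * (wt (k - 1) a / wt k a)"
  shows "log_odds k + ln (D (w(k := True))) = ln (D (w(k := False))) + log_odds (k - 1)"
proof -
  have "wt j a \<noteq> 0" for j a using wt_pos[of j a] by simp
  then show ?thesis unfolding D log_odds_def using assms(1) by (simp add: ln_mult ln_div wt_pos)
qed

text \<open>The integral of the \<open>k\<close>-th centred coordinate against \<open>D\<close> is its mean under the shifted product,
that is, the difference of two successive weights.\<close>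

lemma dev_jumps: "(\<lambda>n. dev (Suc n) - dev n) \<longlonglongrightarrow> 0"
proof -
  have Di: "integrable X D"
  proof (rule integrableI_nonneg)
    have "(\<integral>\<^sup>+w. ennreal (D w) \<partial>X) = (\<integral>\<^sup>+w. 1 \<partial>Q.X)" using nn_integral_Q[of "\<lambda>_. 1"] by simp
    also have "\<dots> < \<infinity>" using Q.X.emeasure_space_1 by simp
    finally show "(\<integral>\<^sup>+w. ennreal (D w) \<partial>X) < \<infinity>" .
  qed (use D_nonneg in auto)
  have "(\<integral>w. D w * centred k w \<partial>X) = wt (k - 1) False - wt k False" for k
  proof -
    have [measurable]: "centred k \<in> borel_measurable Q.X"
      using centred_measurable[of k] by (simp add: measurable_cong_sets[OF sets_Q refl])
    have "(\<integral>w. D w * centred k w \<partial>X) = (\<integral>w. centred k w \<partial>Q.X)"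
      using D_nonneg by (subst density_D[symmetric], subst integral_density) auto
    also have "\<dots> = Q.wt k True * (\<integral>w. centred k (w(k := True)) \<partial>Q.X) + Q.wt k False * (\<integral>w. centred k (w(k := False)) \<partial>Q.X)"
      using centred_bound by (intro Q.integral_resample[where B=1]) auto
    also have "\<dots> = Q.wt k True * (- wt k False) + Q.wt k False * (1 - wt k False)"
      using Q.X.prob_space by (simp add: centred_def)
    also have "\<dots> = Q.wt k False - (Q.wt k True + Q.wt k False) * wt k False" by (simp add: algebra_simps)
    finally show ?thesis unfolding Q.wt_sum by (simp add: Q_wt)
  qed
  then have "(\<lambda>n. wt (int n - 1) False - wt (int n) False) \<longlonglongrightarrow> 0"
    using density_coefficients_vanish[OF Di D_nonneg] by simp
  then have "(\<lambda>n. - (wt (int (Suc n) - 1) False - wt (int (Suc n)) False)) \<longlonglongrightarrow> - 0"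
    by (intro tendsto_minus LIMSEQ_Suc)
  then show ?thesis by (simp add: dev_def)
qed

section \<open>The Maharam extension\<close>

abbreviation M where "M \<equiv> maharam_measure X"
abbreviation S where "S \<equiv> maharam_extension X full_shift"

lemma S_eq: "S (w, y) = (full_shift w, y + ln (D w))"
  by (simp add: maharam_extension_def D_def)

lemma sets_M: "sets M = sets (X \<Otimes>\<^sub>M borel)"
  unfolding maharam_measure_def by (rule sets_pair_measure_cong) simp_all

lemma space_M [simp]: "space M = UNIV"
  by (simp add: maharam_measure_def space_pair_measure)

lemma S_measurable [measurable]: "S \<in> M \<rightarrow>\<^sub>M M"
proof -
  have "(\<lambda>z. (full_shift (fst z), snd z + ln (D (fst z)))) \<in> X \<Otimes>\<^sub>M borel \<rightarrow>\<^sub>M X \<Otimes>\<^sub>M borel"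
    by measurable
  moreover have "S = (\<lambda>z. (full_shift (fst z), snd z + ln (D (fst z))))"
    by (auto simp: S_eq)
  ultimately show ?thesis by (simp add: measurable_cong_sets[OF sets_M sets_M])
qed

definition Sinv where "Sinv z = (unshift (fst z), snd z - ln (D (unshift (fst z))))"

lemma Sinv_S [simp]: "Sinv (S z) = z" "S (Sinv z) = z"
  by (cases z, simp add: S_eq Sinv_def)+

lemma Sinv_measurable [measurable]: "Sinv \<in> M \<rightarrow>\<^sub>M M"
proof -
  have "Sinv \<in> X \<Otimes>\<^sub>M borel \<rightarrow>\<^sub>M X \<Otimes>\<^sub>M borel"
    unfolding Sinv_def[abs_def] by measurable
  then show ?thesis by (simp add: measurable_cong_sets[OF sets_M sets_M])
qed

lemma bij_S: "bij S"
  by (metis Sinv_S bijI')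

lemma the_inv_S: "the_inv_into UNIV S = Sinv"
  by (rule ext) (metis Sinv_S UNIV_I bij_S bij_is_inj the_inv_into_f_f)

lemma invertible_S: "invertible_transformation M S"
  using bij_S by (simp add: invertible_transformation_def the_inv_S)

lemma Sinv_S_pow: "(Sinv ^^ n) ((S ^^ n) z) = z" "(S ^^ n) ((Sinv ^^ n) z) = z"
  by (rule funpow_left_inverse, simp)+

lemma image_pow: "(S ^^ n) ` A = (Sinv ^^ n) -` A" "(Sinv ^^ n) ` A = (S ^^ n) -` A"
  using Sinv_S_pow[of n] by (auto simp: image_iff) metis+

lemma int_iterate_nat: "int_iterate M S (int n) ` A = (Sinv ^^ n) -` A"
  by (simp add: int_iterate_def image_pow)

lemma int_iterate_neg: "int_iterate M S (- int n) ` A = (S ^^ n) -` A"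
  by (cases "n = 0") (simp_all add: int_iterate_def image_pow the_inv_S)

lemma pow_measurable: "S ^^ n \<in> M \<rightarrow>\<^sub>M M" "Sinv ^^ n \<in> M \<rightarrow>\<^sub>M M"
  by (induction n) (auto simp: measurable_ident intro: measurable_comp)

lemma vimage_pow_sets: "A \<in> sets M \<Longrightarrow> (S ^^ n) -` A \<in> sets M" "A \<in> sets M \<Longrightarrow> (Sinv ^^ n) -` A \<in> sets M"
  using measurable_sets[OF pow_measurable(1), of A n] measurable_sets[OF pow_measurable(2), of A n] by simp_all

definition set_flip_inv :: "int \<Rightarrow> ((int \<Rightarrow> bool) \<times> real) set \<Rightarrow> bool" where
  "set_flip_inv k A \<longleftrightarrow>
     (AE w in X. AE y in lborel. (w(k := True), y + log_odds k) \<in> A \<longleftrightarrow> (w(k := False), y) \<in> A)"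

text \<open>By \<open>log_odds_cocycle\<close>, \<open>S\<close> sends the flip at \<open>k\<close> to the flip at \<open>k - 1\<close>; the remaining translation
along the fibre is the same for both points and preserves null sets.\<close>

lemma set_flip_inv_vimage_S:
  assumes "set_flip_inv (k - 1) A" shows "set_flip_inv k (S -` A)"
  unfolding set_flip_inv_def
  using D_flip[of k] AE_full_shift[OF assms[unfolded set_flip_inv_def]]
proof eventually_elim
  case (elim w)
  then obtain u where u: "0 < u" "\<And>a. D (w(k := a)) = u * (wt (k - 1) a / wt k a)" by blast
  have sh: "full_shift (w(k := a)) = (full_shift w)(k - 1 := a)" for a
    by (auto simp: full_shift_def fun_eq_iff)
  note c = log_odds_cocycle[OF u]
  from AE_lborel_translate[OF elim(2), of "ln (D (w(k := False)))"]
  show ?case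
  proof eventually_elim
    case (elim y)
    have y: "y + log_odds k + ln (D (w(k := True))) = y + ln (D (w(k := False))) + log_odds (k - 1)" using c by simp
    show ?case unfolding vimage_eq S_eq sh y by (rule elim)
  qed
qed

lemma set_flip_inv_vimage_pow: "set_flip_inv (k - int n) A \<Longrightarrow> set_flip_inv k ((S ^^ n) -` A)"
proof (induction n arbitrary: k A)
  case (Suc n)
  have "set_flip_inv (k - int n) (S -` A)" using Suc.prems by (intro set_flip_inv_vimage_S) (simp add: algebra_simps)
  then have "set_flip_inv k ((S ^^ n) -` (S -` A))" by (rule Suc.IH)
  then show ?case by (simp only: funpow.simps vimage_comp)
qed simp

text \<open>Membership is insensitive to null sets, so that the inclusion \<open>S\<^sup>-\<^sup>1 \<F> \<subseteq> \<F>\<close> holds exactly, for whichever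
version of the derivative is used.\<close>

definition \<F> :: "((int \<Rightarrow> bool) \<times> real) set set" where
  "\<F> = {A \<in> sets M. \<forall>k\<le>0. set_flip_inv k A}"

lemma sigma_algebra_F: "sigma_algebra UNIV \<F>"
  unfolding sigma_algebra_iff2
proof (intro conjI allI ballI impI)
  show "\<F> \<subseteq> Pow UNIV" by simp
  show "{} \<in> \<F>" by (simp add: \<F>_def set_flip_inv_def)
  show "UNIV - A \<in> \<F>" if "A \<in> \<F>" for A
    using that sets.compl_sets[of A M] by (auto simp: \<F>_def set_flip_inv_def)
  show "(\<Union>i. A i) \<in> \<F>" if A: "range A \<subseteq> \<F>" for A :: "nat \<Rightarrow> _"
  proof -
    have "set_flip_inv k (\<Union>i. A i)" if "k \<le> 0" for k
    proof -
      have "\<forall>i. set_flip_inv k (A i)" using A that by (auto simp: \<F>_def)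
      then have "AE w in X. \<forall>i. AE y in lborel. (w(k := True), y + log_odds k) \<in> A i \<longleftrightarrow> (w(k := False), y) \<in> A i"
        unfolding AE_all_countable by (simp add: set_flip_inv_def)
      then show ?thesis unfolding set_flip_inv_def
      proof eventually_elim
        case (elim w)
        then have "AE y in lborel. \<forall>i. (w(k := True), y + log_odds k) \<in> A i \<longleftrightarrow> (w(k := False), y) \<in> A i"
          by (simp add: AE_all_countable)
        then show ?case by eventually_elim auto
      qed
    qed
    moreover have "(\<Union>i. A i) \<in> sets M" using A by (auto simp: \<F>_def)
    ultimately show ?thesis by (simp add: \<F>_def)
  qed
qed

lemma F_backward: "image_family M S (- 1) \<F> \<subseteq> \<F>"
proof
  fix B assume "B \<in> image_family M S (- 1) \<F>"
  then obtain A where A: "A \<in> \<F>" "B = (S ^^ 1) -` A"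
    using int_iterate_neg[of 1] by (auto simp: image_family_def)
  then show "B \<in> \<F>" using vimage_pow_sets(1)[of A 1]
    by (auto simp: \<F>_def intro: set_flip_inv_vimage_S)
qed

lemma image_family_memI:
  assumes A: "A \<in> sets M" and inv: "\<And>k. k \<le> - int n \<Longrightarrow> set_flip_inv k A"
  shows "A \<in> image_family M S (int n) \<F>"
proof -
  have "set_flip_inv k ((S ^^ n) -` A)" if "k \<le> 0" for k
    using that by (intro set_flip_inv_vimage_pow inv) simp
  then have "(S ^^ n) -` A \<in> \<F>"
    using vimage_pow_sets(1)[OF A] by (simp add: \<F>_def)
  moreover have "A = (Sinv ^^ n) -` ((S ^^ n) -` A)" by (rule set_eqI) (simp add: Sinv_S_pow)
  ultimately show ?thesis unfolding image_family_def
    by (intro image_eqI[of _ _ "(S ^^ n) -` A"]) (simp_all add: int_iterate_nat)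
qed

lemma log_odds_nonpos: "k \<le> 0 \<Longrightarrow> log_odds k = 0"
  using wt_pos[of 0 True] wt_pos[of 0 False] by (simp add: log_odds_def stationary[of k])

text \<open>An event about coordinate \<open>k\<close> is flip-invariant at all other coordinates and hence lies in
\<open>S\<^sup>n \<F>\<close> as soon as \<open>n > - k\<close>; an event about the fibre coordinate is flip-invariant at all
nonpositive coordinates, because flips there do not move the fibre.\<close>

lemma F_generates:
  "sigma_sets UNIV (\<Union>n\<in>{1..}. image_family M S n \<F>) = sets M" (is "sigma_sets UNIV ?G = _")
proof
  have "?G \<subseteq> sets M"
  proof
    fix B assume "B \<in> ?G"
    then obtain n where n: "1 \<le> n" "B \<in> image_family M S n \<F>" by auto
    then obtain m where "n = int m" by (metis zero_le_imp_eq_int order_trans zero_le_one)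
    then show "B \<in> sets M" using n(2)
      by (auto simp: image_family_def int_iterate_nat \<F>_def vimage_pow_sets)
  qed
  then show "sigma_sets UNIV ?G \<subseteq> sets M"
    using sets.sigma_sets_subset[of ?G M] by simp
  let ?s = "sigma UNIV ?G"
  have sp: "space ?s = UNIV" by (rule space_measure_of) simp
  have memb: "A \<in> sets ?s" if "A \<in> sets M" "1 \<le> n" "\<And>k. k \<le> - int n \<Longrightarrow> set_flip_inv k A" for A n
    using image_family_memI[OF that(1,3)] that(2) by (auto intro!: sigma_sets.Basic bexI[of _ "int n"])
  have "fst \<in> ?s \<rightarrow>\<^sub>M X"
  proof (rule measurable_into_X)
    fix k
    show "(\<lambda>z. fst z k) \<in> ?s \<rightarrow>\<^sub>M count_space UNIV"
    proof (rule measurableI)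
      fix C :: "bool set"
      have "{w \<in> space X. w k \<in> C} \<in> sets X" by measurable
      then have "{w. w k \<in> C} \<times> UNIV \<in> sets M" unfolding sets_M by (intro pair_measureI) simp_all
      then have "{w. w k \<in> C} \<times> UNIV \<in> sets ?s"
      proof (rule memb)
        show "1 \<le> nat (max 1 (1 - k))" by linarith
        fix j assume "j \<le> - int (nat (max 1 (1 - k)))"
        then have "j \<noteq> k" by linarith
        then show "set_flip_inv j ({w. w k \<in> C} \<times> UNIV)" by (simp add: set_flip_inv_def)
      qed
      moreover have "(\<lambda>z. fst z k) -` C \<inter> space ?s = {w. w k \<in> C} \<times> UNIV"
        unfolding sp by (rule set_eqI) (simp add: mem_Times_iff)
      ultimately show "(\<lambda>z. fst z k) -` C \<inter> space ?s \<in> sets ?s" by (simp only:)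
    qed simp
  qed
  moreover have "snd \<in> ?s \<rightarrow>\<^sub>M (borel :: real measure)"
  proof (rule measurableI)
    fix C :: "real set" assume C: "C \<in> sets borel"
    then have "UNIV \<times> C \<in> sets M" unfolding sets_M using sets.top[of X] by (intro pair_measureI) simp_all
    then have "UNIV \<times> C \<in> sets ?s"
      by (rule memb[of _ 1]) (simp_all add: set_flip_inv_def log_odds_nonpos)
    moreover have "snd -` C \<inter> space ?s = UNIV \<times> C"
      unfolding sp by (rule set_eqI) (simp add: mem_Times_iff)
    ultimately show "snd -` C \<inter> space ?s \<in> sets ?s" by (simp only:)
  qed simp
  ultimately have "(\<lambda>z. (fst z, snd z)) \<in> ?s \<rightarrow>\<^sub>M X \<Otimes>\<^sub>M borel" by (rule measurable_Pair)
  then have id: "(\<lambda>z. z) \<in> ?s \<rightarrow>\<^sub>M X \<Otimes>\<^sub>M borel" by simp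
  show "sets M \<subseteq> sigma_sets UNIV ?G"
  proof
    fix A assume "A \<in> sets M"
    then show "A \<in> sigma_sets UNIV ?G" using measurable_sets[OF id, of A] by (simp add: sets_M)
  qed
qed

lemma null_M:
  assumes A: "A \<in> sets M" and ae: "AE w in X. AE y in lborel. (w, y) \<notin> A"
  shows "A \<in> null_sets M"
proof -
  let ?n = "density lborel (\<lambda>s. ennreal (exp (- s)))"
  interpret n: sigma_finite_measure ?n
    by (subst sigma_finite_measure.sigma_finite_iff_density_finite[OF sigma_finite_lborel]) auto
  interpret pair_sigma_finite X ?n ..
  have "AE z in X \<Otimes>\<^sub>M ?n. z \<notin> A"
  proof (rule AE_pair_measure)
    have "- A \<in> sets M" using sets.compl_sets[OF A] by (simp add: Compl_eq_Diff_UNIV)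
    then show "{z \<in> space (X \<Otimes>\<^sub>M ?n). z \<notin> A} \<in> sets (X \<Otimes>\<^sub>M ?n)"
      unfolding maharam_measure_def[symmetric] by (simp add: Compl_eq)
    show "AE w in X. AE y in ?n. (w, y) \<notin> A"
      using ae by eventually_elim (auto simp: AE_density)
  qed
  then have "AE z in M. z \<notin> A" unfolding maharam_measure_def .
  then show ?thesis using A by (simp add: AE_iff_null_sets)
qed

lemma tail_F:
  assumes ab: "abundant log_odds"
  shows "equal_mod_null M (\<Inter>n. image_family M S n \<F>) {{}, space M}"
proof -
  have tail: "A \<in> null_sets M \<or> - A \<in> null_sets M" if A: "A \<in> (\<Inter>n. image_family M S n \<F>)" for A
  proof -
    have ex: "\<exists>B\<in>\<F>. A = (S ^^ m) -` B" for m
    proof -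
      have "A \<in> image_family M S (- int m) \<F>" using A by blast
      then show ?thesis by (auto simp: image_family_def int_iterate_neg)
    qed
    have AM: "A \<in> sets M" using ex[of 0] by (auto simp: \<F>_def)
    have inv: "set_flip_inv k A" for k
    proof -
      obtain B where "B \<in> \<F>" "A = (S ^^ nat k) -` B" using ex by blast
      then show ?thesis by (auto simp: \<F>_def intro!: set_flip_inv_vimage_pow)
    qed
    have cA: "- A \<in> sets M" using sets.compl_sets[OF AM] by (simp add: Compl_eq_Diff_UNIV)
    from invariant_sets_trivial[OF ab, of A] AM inv
    have "(AE w in X. AE y in lborel. (w, y) \<notin> A) \<or> (AE w in X. AE y in lborel. (w, y) \<in> A)"
      by (simp add: sets_M set_flip_inv_def)
    then show ?thesis using null_M[OF AM] null_M[OF cA] by auto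
  qed
  have mem: "{} \<in> image_family M S n \<F>" "UNIV \<in> image_family M S n \<F>" for n
  proof -
    have 0: "{} \<in> \<F>" "UNIV \<in> \<F>"
      using sets.top[of M] by (auto simp: \<F>_def set_flip_inv_def)
    have "int_iterate M S n ` UNIV = UNIV"
    proof (cases "0 \<le> n")
      case True
      then show ?thesis using int_iterate_nat[of "nat n" UNIV] by simp
    next
      case False
      then show ?thesis using int_iterate_neg[of "nat (- n)" UNIV] by simp
    qed
    then show "{} \<in> image_family M S n \<F>" "UNIV \<in> image_family M S n \<F>"
      unfolding image_family_def using 0 by (metis image_empty imageI)+
  qed
  show ?thesis unfolding equal_mod_null_def
  proof (intro conjI ballI)
    fix A assume "A \<in> (\<Inter>n. image_family M S n \<F>)"
    from tail[OF this] show "\<exists>B\<in>{{}, space M}. sym_diff A B \<in> null_sets M"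
      by (auto simp: Compl_eq_Diff_UNIV)
  next
    fix B assume "B \<in> {{}, space M}"
    then have "B \<in> (\<Inter>n. image_family M S n \<F>)" using mem by auto
    then show "\<exists>A\<in>(\<Inter>n. image_family M S n \<F>). sym_diff A B \<in> null_sets M"
      by (intro bexI[of _ B]) auto
  qed
qed

lemma invariant_stationary_product: "invariant_measure B full_shift"
proof -
  have "distr B B (\<lambda>w. \<lambda>n\<in>UNIV. w (n + 1)) = B"
    using prob_P by (intro distr_PiM_reindex) (auto simp: inj_on_def)
  moreover have "(\<lambda>w. \<lambda>n\<in>UNIV. w (n + 1)) = full_shift" by (auto simp: full_shift_def fun_eq_iff)
  ultimately show ?thesis using B.full_shift_measurable by (simp add: invariant_measure_def)
qed

lemma maharam_K:
  assumes cons: "conservative X full_shift"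
    and no_acip: "\<not> (\<exists>N. prob_space N \<and> sets N = sets X \<and> absolutely_continuous X N \<and> invariant_measure N full_shift)"
  shows "K_transformation M S"
proof -
  have "\<not> summable (\<lambda>n. (dev n)\<^sup>2)"
    using no_acip absolutely_continuous_stationary_product sets_B invariant_stationary_product B.X.prob_space_axioms
    by blast
  then have ab: "abundant log_odds" by (intro abundant_log_odds cons dev_jumps)
  have "equal_mod_null M (sets M) (sets M)"
    unfolding equal_mod_null_def by (metis Diff_cancel Un_empty_left null_sets.empty_sets)
  moreover have "\<F> \<subseteq> sets M" by (auto simp: \<F>_def)
  ultimately show ?thesis
    unfolding K_transformation_def space_M
    using invertible_S sigma_algebra_F F_backward tail_F[OF ab] F_generates space_M
    by metis
qed

end

theorem theorem3p2:
  fixes P :: "int \<Rightarrow> bool measure"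
  assumes "nonsingular_K_shift P"
    and "conservative (bernoulli_product P) full_shift"
    and "\<not> (\<exists>N. prob_space N \<and> sets N = sets (bernoulli_product P) \<and>
              absolutely_continuous (bernoulli_product P) N \<and> invariant_measure N full_shift)"
  shows "K_transformation (maharam_measure (bernoulli_product P))
           (maharam_extension (bernoulli_product P) full_shift)"
proof -
  have ns: "nonsingular (bernoulli_product P) full_shift" and hs: "half_stationary P"
    using assms(1) by (auto simp: nonsingular_K_shift_def)
  interpret bernoulli_factors P
    using hs by (intro bernoulli_factors.intro) (auto simp: half_stationary_def)
  obtain p where p: "0 < p" "p < 1" "\<And>k. k \<le> 0 \<Longrightarrow> wt k False = p \<and> 1 - wt k True = p"
    using hs unfolding half_stationary_def wt_def by blast
  have st: "wt k a = wt 0 a" if "k \<le> 0" for k a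
    using p(3)[OF that] p(3)[of 0] by (cases a) auto
  have "0 < wt 0 a" for a using p(1,2) p(3)[of 0] by (cases a) auto
  then have pos: "0 < wt k a" for k a by (rule nonsingular_wt_pos[OF ns])
  interpret nonsingular_shift P
    by unfold_locales (fact pos, fact st, fact ns)
  show ?thesis by (rule maharam_K[OF assms(2,3)])
qed

end
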